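(* The 2D-HC map $F_{2\mathrm D}\colon[0,1]^2\to[0,1]^2$ and the 3D-HC map $F\colon[0,1]^3\to[0,1]^3$ are hetero-chaotic.
   Context: **Maps.** Define $\tau\colon[0,1]\to[0,1]$ by $\tau(x)=3x \bmod 1$ for $0\le x<1$ and $\tau(1)=1$. Let $A=[0,\frac13)\times[0,1]\times[0,1]$, $B=[\frac23,1]\times[0,1]\times[0,\frac12)$, $C=[\frac23,1]\times[0,1]\times[\frac12,1]$, $D=[\frac13,\frac23)\times[0,1]\times[0,1]$. The 3D-HC map $F\colon[0,1]^3\to[0,1]^3$ is $F(x,y,z)=(\tau(x),\frac23y,\frac12z)$ on $A$; $F(x,y,z)=(\tau(x),\frac23+\frac16y,2z)$ on $B$; $F(x,y,z)=(\tau(x),\frac56+\frac16y,-1+2z)$ on $C$; $F(x,y,z)=(\tau(x),\frac23y,\frac12+\frac12z)$ on $D$. The 2D-HC map $F_{2\mathrm D}\colon[0,1]^2\to[0,1]^2$ is $F_{2\mathrm D}(x,z)=\pi(F(x,0,z))$, where $\pi\colon[0,1]^3\to[0,1]^2$ is the projection $\pi(x,y,z)=(x,z)$. **Periodic points.** Let $G\colon M\to M$ be a piecewise differentiable map. A point $p\in M$ is a periodic point of period $n$ ($n\ge1$) if $G^n(p)=p$. If $p$ is a periodic point of period $n$ and $G^n$ is differentiable at $p$, the unstable dimension of $p$ is the number of eigenvalues of the Jacobian matrix $DG^n(p)$ outside the unit disk $\{z\in\mathbb C:|z|\le1\}$, counted with multiplicity; $p$ is $k$-unstable if its unstable dimension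 equals $k$, and $p$ is hyperbolic if no eigenvalue of $DG^n(p)$ lies on the unit circle. **Hetero-chaos.** A set $\Lambda\subset M$ is invariant if $G(\Lambda)=\Lambda$. An invariant set $\Lambda\subset M$ is hetero-chaotic (and $G$ is said to be hetero-chaotic on $\Lambda$) if: (i) $\Lambda$ is an uncountable closed set; (ii$'$) for at least two values of $k$, the set of $k$-unstable hyperbolic periodic points is dense in $\Lambda$; (iii) $\Lambda$ has a dense trajectory, i.e., there exists $x_0\in\Lambda$ such that the set $(G^n(x_0))_{n\in\mathbb N}$ is dense in $\Lambda$, where $\mathbb N$ is the set of non-negative integers. In the case $\Lambda=M$ one simply says that $G$ is hetero-chaotic; thus "$G$ is hetero-chaotic" means that $G(M)=M$ and (i), (ii$'$), (iii) hold with $\Lambda=M$. Here $M=[0,1]^2$ for $F_{2\mathrm D}$ and $M=[0,1]^3$ for $F$.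
   Formalization: For the 3D-HC map, F(M)=M is false as defined (e.g. (1,0,0) has no preimage); it is replaced by int(M) ⊆ F(M) ⊆ M, while (i), (ii′), (iii) with Λ=M are kept. The 2D claim is proved literally. *)

theory Defs
  imports "HOL-Analysis.Analysis" "HOL-Computational_Algebra.Polynomial"
begin

definition tau :: "real \<Rightarrow> real" where
  "tau x = (if x = 1 then 1 else frac (3 * x))"

text \<open>Throughout, coordinates \<open>(x, y, z)\<close> of the cube are the components 1, 2, 3 of a vector in
  \<open>real ^ 3\<close>, and coordinates \<open>(x, z)\<close> of the square are the components 1, 2 of a vector
  in \<open>real ^ 2\<close>.\<close>

definition unit_cube :: "(real ^ 'n) set" where
  "unit_cube = {v. \<forall>i. v $ i \<in> {0..1}}"

definition A_reg :: "(real ^ 3) set" where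
  "A_reg = {v. v $ 1 \<in> {0..<1/3} \<and> v $ 2 \<in> {0..1} \<and> v $ 3 \<in> {0..1}}"

definition B_reg :: "(real ^ 3) set" where
  "B_reg = {v. v $ 1 \<in> {2/3..1} \<and> v $ 2 \<in> {0..1} \<and> v $ 3 \<in> {0..<1/2}}"

definition C_reg :: "(real ^ 3) set" where
  "C_reg = {v. v $ 1 \<in> {2/3..1} \<and> v $ 2 \<in> {0..1} \<and> v $ 3 \<in> {1/2..1}}"

definition D_reg :: "(real ^ 3) set" where
  "D_reg = {v. v $ 1 \<in> {1/3..<2/3} \<and> v $ 2 \<in> {0..1} \<and> v $ 3 \<in> {0..1}}"

text \<open>The four regions partition the unit cube; outside the cube the map is left unspecified.\<close>

definition F_3D :: "real ^ 3 \<Rightarrow> real ^ 3" where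
  "F_3D v = (let x = v $ 1; y = v $ 2; z = v $ 3 in
     if v \<in> A_reg then vector [tau x, 2/3 * y, 1/2 * z]
     else if v \<in> B_reg then vector [tau x, 2/3 + 1/6 * y, 2 * z]
     else if v \<in> C_reg then vector [tau x, 5/6 + 1/6 * y, -1 + 2 * z]
     else if v \<in> D_reg then vector [tau x, 2/3 * y, 1/2 + 1/2 * z]
     else undefined)"

definition proj_xz :: "real ^ 3 \<Rightarrow> real ^ 2" where
  "proj_xz v = vector [v $ 1, v $ 3]"

definition F_2D :: "real ^ 2 \<Rightarrow> real ^ 2" where
  "F_2D w = proj_xz (F_3D (vector [w $ 1, 0, w $ 2]))"

definition char_polynomial :: "real ^ 'n ^ 'n \<Rightarrow> complex poly" where
  "char_polynomial A = det (mat [:0, 1:] - (\<chi> i j. [:complex_of_real (A $ i $ j):]))"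

text \<open>The complex eigenvalues, with algebraic multiplicity.\<close>

definition eigenvalues :: "real ^ 'n ^ 'n \<Rightarrow> complex multiset" where
  "eigenvalues A = proots (char_polynomial A)"

text \<open>A phase space \<open>M\<close> is a subset of \<open>real ^ 'n\<close>, and a map \<open>G\<close> of \<open>M\<close> into itself is represented
  by a total function whose values outside \<open>M\<close> are irrelevant. Accordingly, derivatives are taken
  within \<open>M\<close>. The \<open>jacobian\<close> is then meaningful at points where derivatives within \<open>M\<close> are unique,
  which is the case at every point of the unit cube, including its boundary.\<close>

definition periodic_point :: "(real ^ 'n) set \<Rightarrow> (real ^ 'n \<Rightarrow> real ^ 'n) \<Rightarrow> nat \<Rightarrow> real ^ 'n \<Rightarrow> bool"
  where "periodic_point M G n p \<longleftrightarrow> p \<in> M \<and> n \<ge> 1 \<and> (G ^^ n) p = p"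

definition multipliers ::
    "(real ^ 'n) set \<Rightarrow> (real ^ 'n \<Rightarrow> real ^ 'n) \<Rightarrow> nat \<Rightarrow> real ^ 'n \<Rightarrow> complex multiset" where
  "multipliers M G n p = eigenvalues (jacobian (G ^^ n) (at p within M))"

definition unstable_dim ::
    "(real ^ 'n) set \<Rightarrow> (real ^ 'n \<Rightarrow> real ^ 'n) \<Rightarrow> nat \<Rightarrow> real ^ 'n \<Rightarrow> nat" where
  "unstable_dim M G n p = size {# \<mu> \<in># multipliers M G n p. norm \<mu> > 1 #}"

definition hyperbolic ::
    "(real ^ 'n) set \<Rightarrow> (real ^ 'n \<Rightarrow> real ^ 'n) \<Rightarrow> nat \<Rightarrow> real ^ 'n \<Rightarrow> bool" where
  "hyperbolic M G n p \<longleftrightarrow> (\<forall>\<mu> \<in># multipliers M G n p. norm \<mu> \<noteq> 1)"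

text \<open>The period \<open>n\<close> need not be minimal.\<close>

definition unstable_hyperbolic_points ::
    "(real ^ 'n) set \<Rightarrow> (real ^ 'n \<Rightarrow> real ^ 'n) \<Rightarrow> nat \<Rightarrow> (real ^ 'n) set" where
  "unstable_hyperbolic_points M G k =
     {p. \<exists>n. periodic_point M G n p \<and> (G ^^ n) differentiable (at p within M) \<and>
             unstable_dim M G n p = k \<and> hyperbolic M G n p}"

definition dense_in :: "'a::topological_space set \<Rightarrow> 'a set \<Rightarrow> bool" where
  "dense_in S \<Lambda> \<longleftrightarrow> \<Lambda> \<subseteq> closure (S \<inter> \<Lambda>)"

definition invariant_set :: "('a \<Rightarrow> 'a) \<Rightarrow> 'a set \<Rightarrow> bool" where
  "invariant_set G \<Lambda> \<longleftrightarrow> G ` \<Lambda> = \<Lambda>"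

text \<open>The clauses (i), (ii') and (iii) of hetero-chaos, without the invariance of \<open>\<Lambda>\<close>.\<close>

definition hetero_chaos_clauses ::
    "(real ^ 'n) set \<Rightarrow> (real ^ 'n \<Rightarrow> real ^ 'n) \<Rightarrow> (real ^ 'n) set \<Rightarrow> bool" where
  "hetero_chaos_clauses M G \<Lambda> \<longleftrightarrow>
     uncountable \<Lambda> \<and> closedin (top_of_set M) \<Lambda> \<and>
     (\<exists>k l. k \<noteq> l \<and> dense_in (unstable_hyperbolic_points M G k) \<Lambda> \<and>
                    dense_in (unstable_hyperbolic_points M G l) \<Lambda>) \<and>
     (\<exists>x0\<in>\<Lambda>. dense_in (range (\<lambda>n. (G ^^ n) x0)) \<Lambda>)"

definition hetero_chaotic_on ::
    "(real ^ 'n) set \<Rightarrow> (real ^ 'n \<Rightarrow> real ^ 'n) \<Rightarrow> (real ^ 'n) set \<Rightarrow> bool" where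
  "hetero_chaotic_on M G \<Lambda> \<longleftrightarrow> \<Lambda> \<subseteq> M \<and> invariant_set G \<Lambda> \<and> hetero_chaos_clauses M G \<Lambda>"

definition hetero_chaotic :: "(real ^ 'n) set \<Rightarrow> (real ^ 'n \<Rightarrow> real ^ 'n) \<Rightarrow> bool" where
  "hetero_chaotic M G \<longleftrightarrow> hetero_chaotic_on M G M"

text \<open>With the conventions chosen for \<open>F_3D\<close> on the faces of the regions, the identity
  \<open>F_3D ` unit_cube = unit_cube\<close> fails, so \<open>F_3D\<close> is not literally \<open>hetero_chaotic\<close>: the only
  preimage of 1 under \<open>tau\<close> is 1, so a point \<open>(1, y, z)\<close> with \<open>y < 2/3\<close> has no preimage; likewise
  \<open>(x, y, 1)\<close> with \<open>2/3 < y < 5/6\<close>.\<close>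

lemma F_3D_image_neq_unit_cube: "F_3D ` unit_cube \<noteq> unit_cube"
proof
  assume eq: "F_3D ` unit_cube = unit_cube"
  have "(vector [1, 0, 0] :: real ^ 3) \<in> unit_cube"
    by (auto simp: unit_cube_def forall_3)
  then obtain v where v: "v \<in> unit_cube" "F_3D v = vector [1, 0, 0]"
    by (metis eq imageE)
  have tau: "tau x = 1 \<Longrightarrow> x = 1" for x
    using frac_lt_1[of "3 * x"] by (auto simp: tau_def split: if_splits)
  have bounds: "0 \<le> v $ 1" "v $ 1 \<le> 1" "0 \<le> v $ 2" "v $ 2 \<le> 1" "0 \<le> v $ 3" "v $ 3 \<le> 1"
    using v(1) by (auto simp: unit_cube_def)
  have "v \<in> A_reg \<union> B_reg \<union> C_reg \<union> D_reg"
    using bounds by (auto simp: A_reg_def B_reg_def C_reg_def D_reg_def)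
  then have "F_3D v $ 1 = tau (v $ 1)"
    by (auto simp: F_3D_def Let_def)
  then have "v $ 1 = 1"
    using v(2) tau by simp
  then have "F_3D v $ 2 \<ge> 2/3"
    using bounds
    by (auto simp: F_3D_def Let_def A_reg_def B_reg_def C_reg_def D_reg_def)
  then show False
    using v(2) by simp
qed

corollary F_3D_not_hetero_chaotic: "\<not> hetero_chaotic unit_cube F_3D"
  using F_3D_image_neq_unit_cube
  by (simp add: hetero_chaotic_def hetero_chaotic_on_def invariant_set_def)

text \<open>All the missing image points lie on the boundary of the cube. For \<open>F_3D\<close>, the equality
  \<open>G ` M = M\<close> is therefore required up to boundary points of \<open>M\<close>; the other clauses of
  hetero-chaos are unchanged.\<close>

definition hetero_chaotic_up_to_boundary ::
    "(real ^ 'n) set \<Rightarrow> (real ^ 'n \<Rightarrow> real ^ 'n) \<Rightarrow> bool" where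
  "hetero_chaotic_up_to_boundary M G \<longleftrightarrow>
     G ` M \<subseteq> M \<and> interior M \<subseteq> G ` M \<and> hetero_chaos_clauses M G M"

lemma hetero_chaotic_imp_up_to_boundary:
  "hetero_chaotic M G \<Longrightarrow> hetero_chaotic_up_to_boundary M G"
  using interior_subset[of M]
  by (simp add: hetero_chaotic_def hetero_chaotic_on_def invariant_set_def
      hetero_chaotic_up_to_boundary_def)

end

theory Submission
  imports Defs
begin

text \<open>The third coordinate behaves like a stack of binary digits. The pieces \<open>A\<close> and \<open>D\<close> push
  the digit 0 or 1 (they halve \<open>z\<close>), the pieces \<open>B\<close> and \<open>C\<close> pop the top digit, which decides
  between the two (they double \<open>z\<close>). The first coordinate is a ternary expansion of the future
  itinerary, and the second coordinate is contracted at each step into an interval that tells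
  whether the last step was a push, and otherwise which digit it popped. So \<open>F_3D\<close> expands in \<open>x\<close>, contracts in \<open>y\<close>, and in \<open>z\<close> it expands or
  contracts along an orbit according to whether pops or pushes prevail. Both kinds of periodic
  orbit exist, and the itineraries can be chosen so freely that both are dense.

  The proof is phrased with inverse branches of iterates: increasing affine maps \<open>u\<close>, \<open>g\<close>, \<open>w\<close>
  with \<open>F_3D ^^ n\<close> sending \<open>(u x, y, w z)\<close> to \<open>(x, g y, z)\<close> for \<open>x\<close>, \<open>z\<close> in given target sets
  and \<^emph>\<open>all\<close> \<open>y\<close> in the unit interval. Inverse branches compose, and three constructions
  steer them. By \<open>full_expansion\<close>, every open rectangle in \<open>(x, z)\<close> contains one that an iterate
  stretches over the whole open unit square. By \<open>branch_into_box\<close>, every open box of the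
  cube is reached by an iterate from a full column over some open rectangle. By
  \<open>prescribe_z_by_pushing\<close>, pushes shrink the whole unit interval of \<open>z\<close> into any prescribed
  place. Closing up the first two gives an iterate that fixes a point of a given box and expands
  \<open>z\<close>; inserting the third in between gives one that contracts \<open>z\<close>
  (\<open>branch_fixed_points_of_both_types\<close>). There the iterate is affine with diagonal linear part,
  so the multipliers are \<open>3 ^ n\<close>, a number below 1, and the slope in \<open>z\<close>: the unstable dimension
  is 2 or 1.

  The first two constructions also show that inside every open rectangle there is an open
  rectangle over which the full column enters a given box, so Baire's theorem yields a point whose
  orbit enters all boxes (\<open>dense_orbit\<close>). Everything in dimension two is the image of this
  under the projection \<open>proj_xz\<close>, which semiconjugates \<open>F_3D\<close> to \<open>F_2D\<close>.\<close>

section \<open>Increasing affine maps of the line\<close>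

definition has_slope :: "(real \<Rightarrow> real) \<Rightarrow> real \<Rightarrow> bool" where
  "has_slope f c \<longleftrightarrow> c > 0 \<and> (\<forall>x. f x = f 0 + c * x)"

lemma has_slopeD: "has_slope f c \<Longrightarrow> f x = f 0 + c * x"
  unfolding has_slope_def by blast

lemma has_slope_pos: "has_slope f c \<Longrightarrow> c > 0"
  unfolding has_slope_def by blast

lemma has_slope_diff: "has_slope f c \<Longrightarrow> f x - f y = c * (x - y)"
  using has_slopeD[of f c x] has_slopeD[of f c y] by (simp add: algebra_simps)

lemma has_slope_id: "has_slope id 1"
  by (simp add: has_slope_def)

lemma has_slope_compose:
  assumes "has_slope f c" "has_slope g d"
  shows "has_slope (f \<circ> g) (c * d)"
  unfolding has_slope_def
proof (intro conjI allI)
  show "c * d > 0"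
    using assms by (simp add: has_slope_pos)
  show "(f \<circ> g) x = (f \<circ> g) 0 + c * d * x" for x
    using has_slope_diff[OF assms(1), of "g x" "g 0"] has_slope_diff[OF assms(2), of x 0]
    by (simp add: algebra_simps)
qed

lemma has_slope_less_iff: "has_slope f c \<Longrightarrow> f x < f y \<longleftrightarrow> x < y"
  using has_slope_diff[of f c y x] has_slope_pos[of f c]
  by (metis diff_gt_0_iff_gt zero_less_mult_iff not_less_iff_gr_or_eq)

lemma has_slope_continuous: "has_slope f c \<Longrightarrow> continuous_on S f"
  by (rule continuous_on_eq[where f = "\<lambda>x. f 0 + c * x"])
     (intro continuous_intros, metis has_slopeD)

lemma has_slope_inverse:
  assumes "has_slope f c"
  obtains f' where "has_slope f' (1 / c)" "\<And>x. f (f' x) = x" "\<And>x. f' (f x) = x"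
proof
  have c: "c > 0"
    using has_slope_pos[OF assms] .
  note f = has_slopeD[OF assms]
  show "has_slope (\<lambda>x. (x - f 0) / c) (1 / c)"
    using c by (simp add: has_slope_def field_simps)
  show "f ((x - f 0) / c) = x" for x
    using f[of "(x - f 0) / c"] c by simp
  show "(f x - f 0) / c = x" for x
    using f[of x] c by simp
qed

lemma has_slope_open_vimage: "has_slope f c \<Longrightarrow> open S \<Longrightarrow> open (f -` S)"
  using has_slope_continuous[of f c UNIV] by (rule open_vimage[rotated])

lemma has_slope_open_image:
  assumes "has_slope f c" "open S" shows "open (f ` S)"
proof -
  obtain f' where f': "has_slope f' (1 / c)" "\<And>x. f (f' x) = x" "\<And>x. f' (f x) = x"
    using has_slope_inverse assms(1) by blast
  have "f ` S = f' -` S"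
    using f'(2,3) by (auto simp: image_iff) metis
  then show ?thesis
    using has_slope_open_vimage f'(1) assms(2) by simp
qed

text \<open>A branch of small slope localizes: it puts the whole unit interval near each of its values.\<close>
lemma has_slope_image_ball:
  assumes "has_slope f c" "x \<in> {0..1}" "c < e"
  shows "f ` {0..1} \<subseteq> {f x - e<..<f x + e}"
proof
  fix v assume "v \<in> f ` {0..1}"
  then obtain t where t: "v = f t" "t \<in> {0..1}" by blast
  have "\<bar>v - f x\<bar> = c * \<bar>t - x\<bar>"
    using has_slope_diff[OF assms(1), of t x] has_slope_pos[OF assms(1)] t by (simp add: abs_mult)
  also have "\<dots> \<le> c * 1"
    using t assms has_slope_pos[OF assms(1)] by (intro mult_left_mono) auto
  finally show "v \<in> {f x - e<..<f x + e}"
    using assms(3) by auto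
qed

text \<open>The inequalities at the endpoints give a fixed point and also decide whether the slope is below
  or above 1. In this way the stability type of a periodic point is read off from an inclusion of
  intervals instead of a count of symbols in its itinerary.\<close>
lemma has_slope_fixed_point_contracting:
  assumes f: "has_slope f c" and "a < b" "a < f a" "f b < b"
  shows "c < 1" "\<exists>x\<in>{a<..<b}. f x = x"
proof -
  have "f b - f a = c * (b - a)"
    using has_slope_diff[OF f] .
  moreover have "f b - f a < b - a"
    using assms by linarith
  ultimately have "c * (b - a) < 1 * (b - a)"
    by simp
  then show c: "c < 1"
    using assms(2) by simp
  have "f (f 0 / (1 - c)) = f 0 / (1 - c)"
    using has_slopeD[OF f, of "f 0 / (1 - c)"] c by (simp add: field_simps)
  moreover have "a < f 0 / (1 - c)" "f 0 / (1 - c) < b"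
    using assms c has_slopeD[OF f, of a] has_slopeD[OF f, of b] by (simp_all add: field_simps)
  ultimately show "\<exists>x\<in>{a<..<b}. f x = x" by auto
qed

lemma has_slope_fixed_point_expanding:
  assumes f: "has_slope f c" and "a < b" "f a < a" "b < f b"
  shows "c > 1" "\<exists>x\<in>{a<..<b}. f x = x"
proof -
  have "f b - f a = c * (b - a)"
    using has_slope_diff[OF f] .
  moreover have "f b - f a > b - a"
    using assms by linarith
  ultimately have "c * (b - a) > 1 * (b - a)"
    by simp
  then show c: "c > 1"
    using assms(2) by simp
  have "f (f 0 / (1 - c)) = f 0 / (1 - c)"
    using has_slopeD[OF f, of "f 0 / (1 - c)"] c by (simp add: field_simps)
  moreover have "a < f 0 / (1 - c)" "f 0 / (1 - c) < b"
    using assms c has_slopeD[OF f, of a] has_slopeD[OF f, of b] by (simp_all add: field_simps)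
  ultimately show "\<exists>x\<in>{a<..<b}. f x = x" by auto
qed

section \<open>Inverse branches of iterates\<close>

abbreviation open_unit :: "real set" where
  "open_unit \<equiv> {0<..<1}"

text \<open>The branch is described by its target \<open>P \<times> Q\<close> in \<open>(x, z)\<close>; its domain is the image of the
  target under \<open>u\<close> and \<open>w\<close>. Targets are shrunk at will, whereas domains would have to be recomputed
  at each composition. The coordinate \<open>y\<close> goes forward through \<open>g\<close> because it is contracted, and
  it is never restricted: this is what makes columns over rectangles the right sets to move around.
  The slope of \<open>w\<close> is left open: it depends on the numbers of pushes and pops, while the
  length \<open>n\<close> determines the slope of \<open>u\<close> and bounds that of \<open>g\<close>.\<close>
definition inverse_branch ::
    "nat \<Rightarrow> real set \<Rightarrow> real set \<Rightarrow> (real \<Rightarrow> real) \<Rightarrow> (real \<Rightarrow> real) \<Rightarrow> (real \<Rightarrow> real) \<Rightarrow> bool" where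
  "inverse_branch n P Q u g w \<longleftrightarrow>
     has_slope u ((1/3) ^ n) \<and> (\<exists>r. has_slope g r \<and> r \<le> (2/3) ^ n) \<and> (\<exists>k. has_slope w k) \<and>
     P \<subseteq> open_unit \<and> Q \<subseteq> open_unit \<and> u ` P \<subseteq> open_unit \<and> w ` Q \<subseteq> open_unit \<and>
     g ` {0..1} \<subseteq> {0..1} \<and>
     (\<forall>x\<in>P. \<forall>y\<in>{0..1}. \<forall>z\<in>Q. (F_3D ^^ n) (vector [u x, y, w z]) = vector [x, g y, z])"

lemma inverse_branchI:
  assumes "has_slope u ((1/3) ^ n)" "has_slope g r" "r \<le> (2/3) ^ n" "has_slope w k"
    and "\<And>x. x \<in> P \<Longrightarrow> x \<in> open_unit \<and> u x \<in> open_unit"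
    and "\<And>z. z \<in> Q \<Longrightarrow> z \<in> open_unit \<and> w z \<in> open_unit"
    and "\<And>y. y \<in> {0..1} \<Longrightarrow> g y \<in> {0..1}"
    and "\<And>x y z. x \<in> P \<Longrightarrow> y \<in> {0..1} \<Longrightarrow> z \<in> Q \<Longrightarrow>
           (F_3D ^^ n) (vector [u x, y, w z]) = vector [x, g y, z]"
  shows "inverse_branch n P Q u g w"
proof -
  have "P \<subseteq> open_unit" "Q \<subseteq> open_unit" "u ` P \<subseteq> open_unit" "w ` Q \<subseteq> open_unit"
    "g ` {0..1} \<subseteq> {0..1}"
    using assms(5-7) by blast+
  then show ?thesis
    unfolding inverse_branch_def using assms(1-4,8) by blast
qed

lemma inverse_branchD:
  assumes "inverse_branch n P Q u g w"
  shows "has_slope u ((1/3) ^ n)" "\<exists>r. has_slope g r \<and> r \<le> (2/3) ^ n" "\<exists>k. has_slope w k"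
    and "P \<subseteq> open_unit" "Q \<subseteq> open_unit" "u ` P \<subseteq> open_unit" "w ` Q \<subseteq> open_unit"
    and "\<And>y. y \<in> {0..1} \<Longrightarrow> g y \<in> {0..1}"
    and "\<And>x y z. x \<in> P \<Longrightarrow> y \<in> {0..1} \<Longrightarrow> z \<in> Q \<Longrightarrow>
           (F_3D ^^ n) (vector [u x, y, w z]) = vector [x, g y, z]"
  using assms unfolding inverse_branch_def by (simp_all only: image_subset_iff) blast+

lemma inverse_branch_mono:
  assumes "inverse_branch n P Q u g w" "P' \<subseteq> P" "Q' \<subseteq> Q"
  shows "inverse_branch n P' Q' u g w"
proof -
  note D = inverse_branchD[OF assms(1)]
  obtain r k where "has_slope g r" "r \<le> (2/3) ^ n" "has_slope w k"
    using D(2,3) by blast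
  then show ?thesis
  proof (rule inverse_branchI[OF D(1)])
    show "x \<in> open_unit \<and> u x \<in> open_unit" if "x \<in> P'" for x
      using D(4,6) assms(2) that by blast
    show "z \<in> open_unit \<and> w z \<in> open_unit" if "z \<in> Q'" for z
      using D(5,7) assms(3) that by blast
  qed (use D(8,9) assms(2,3) in blast)+
qed

lemma inverse_branch_id:
  "P \<subseteq> open_unit \<Longrightarrow> Q \<subseteq> open_unit \<Longrightarrow> inverse_branch 0 P Q id id id"
  by (rule inverse_branchI[where r = 1 and k = 1]) (auto simp: has_slope_def)

lemma inverse_branch_compose:
  assumes 1: "inverse_branch n P Q u g w" and 2: "inverse_branch m P' Q' u' g' w'"
    and sub: "u' ` P' \<subseteq> P" "w' ` Q' \<subseteq> Q"
  shows "inverse_branch (n + m) P' Q' (u \<circ> u') (g' \<circ> g) (w \<circ> w')"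
proof -
  note D1 = inverse_branchD[OF 1] and D2 = inverse_branchD[OF 2]
  obtain r r' where r: "has_slope g r" "r \<le> (2/3) ^ n" "has_slope g' r'" "r' \<le> (2/3) ^ m"
    using D1(2) D2(2) by blast
  obtain k k' where k: "has_slope w k" "has_slope w' k'"
    using D1(3) D2(3) by blast
  show ?thesis
  proof (rule inverse_branchI)
    show "has_slope (u \<circ> u') ((1/3) ^ (n + m))"
      using has_slope_compose[OF D1(1) D2(1)] by (simp add: power_add)
    show "has_slope (g' \<circ> g) (r' * r)"
      using has_slope_compose r(1,3) by blast
    have "r' * r \<le> (2/3) ^ m * (2/3) ^ n"
      using r(2,4) has_slope_pos[OF r(1)] by (intro mult_mono) auto
    then show "r' * r \<le> (2/3) ^ (n + m)"
      by (simp add: power_add mult.commute)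
    show "has_slope (w \<circ> w') (k * k')"
      using has_slope_compose k by blast
    show "x \<in> open_unit \<and> (u \<circ> u') x \<in> open_unit" if "x \<in> P'" for x
      using D1(6) D2(4) sub(1) that unfolding o_apply by blast
    show "z \<in> open_unit \<and> (w \<circ> w') z \<in> open_unit" if "z \<in> Q'" for z
      using D1(7) D2(5) sub(2) that unfolding o_apply by blast
    show "(g' \<circ> g) y \<in> {0..1}" if "y \<in> {0..1}" for y
      unfolding o_apply using D1(8) D2(8) that by blast
    show "(F_3D ^^ (n + m)) (vector [(u \<circ> u') x, y, (w \<circ> w') z]) = vector [x, (g' \<circ> g) y, z]"
      if "x \<in> P'" "y \<in> {0..1}" "z \<in> Q'" for x y z
    proof -
      have "(F_3D ^^ n) (vector [u (u' x), y, w (w' z)]) = vector [u' x, g y, w' z]"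
        using sub that by (intro D1(9)) auto
      moreover have "(F_3D ^^ m) (vector [u' x, g y, w' z]) = vector [x, g' (g y), z]"
        using that D1(8) by (intro D2(9)) auto
      ultimately show ?thesis
        by (simp add: funpow_add add.commute[of n])
    qed
  qed
qed

lemma tau_inverse_branches:
  assumes "x \<in> open_unit"
  shows "tau (x / 3) = x" "tau ((x + 1) / 3) = x" "tau ((x + 2) / 3) = x"
proof -
  have "tau ((x + k) / 3) = x" if "k \<in> {0, 1, 2}" for k :: real
  proof -
    have "(x + k) / 3 \<noteq> 1" and "3 * ((x + k) / 3) = x + k"
      using that assms by auto
    moreover have "frac (x + k) = x"
      using that assms by (auto simp: frac_unique_iff)
    ultimately show ?thesis
      by (simp only: tau_def if_False)
  qed
  from this[of 0] this[of 1] this[of 2]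
  show "tau (x / 3) = x" "tau ((x + 1) / 3) = x" "tau ((x + 2) / 3) = x"
    by simp_all
qed

text \<open>The pieces \<open>A\<close> and \<open>D\<close> push a binary digit onto \<open>z\<close>, so their images only fill one half of the
  interval; \<open>B\<close> and \<open>C\<close> pop a digit and have full image.\<close>
lemma inverse_branch_A:
  "inverse_branch 1 open_unit {0<..<1/2} (\<lambda>x. x / 3) (\<lambda>y. 2/3 * y) (\<lambda>z. 2 * z)"
  by (rule inverse_branchI[where r = "2/3" and k = 2])
     (auto simp: has_slope_def F_3D_def Let_def A_reg_def tau_inverse_branches)

lemma inverse_branch_D:
  "inverse_branch 1 open_unit {1/2<..<1} (\<lambda>x. (x + 1) / 3) (\<lambda>y. 2/3 * y) (\<lambda>z. 2 * z - 1)"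
  by (rule inverse_branchI[where r = "2/3" and k = 2])
     (auto simp: has_slope_def F_3D_def Let_def A_reg_def B_reg_def C_reg_def D_reg_def tau_inverse_branches
       field_simps)

lemma inverse_branch_B:
  "inverse_branch 1 open_unit open_unit (\<lambda>x. (x + 2) / 3) (\<lambda>y. 2/3 + 1/6 * y) (\<lambda>z. z / 2)"
  by (rule inverse_branchI[where r = "1/6" and k = "1/2"])
     (auto simp: has_slope_def F_3D_def Let_def A_reg_def B_reg_def tau_inverse_branches field_simps)

lemma inverse_branch_C:
  "inverse_branch 1 open_unit open_unit (\<lambda>x. (x + 2) / 3) (\<lambda>y. 5/6 + 1/6 * y) (\<lambda>z. (1 + z) / 2)"
  by (rule inverse_branchI[where r = "1/6" and k = "1/2"])
     (auto simp: has_slope_def F_3D_def Let_def A_reg_def B_reg_def C_reg_def tau_inverse_branches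
       field_simps)

section \<open>Prescribing itineraries\<close>

lemma open_minus_half:
  fixes Z :: "real set"
  assumes "open Z" "Z \<noteq> {}" "Z \<subseteq> open_unit"
  shows "Z \<inter> {0<..<1/2} \<noteq> {} \<or> Z \<inter> {1/2<..<1} \<noteq> {}"
proof (rule ccontr)
  assume "\<not> ?thesis"
  then have "Z \<subseteq> {1/2}"
    using assms(3) by force
  then show False
    using assms(1,2) not_open_singleton by (metis subset_singletonD)
qed

text \<open>The height \<open>y\<close> dictates the step that leads to it, up to the choice between \<open>A\<close> and \<open>D\<close>, whose
  images have the same \<open>y\<close>-interval. This choice is spent on hitting \<open>Z\<close>.\<close>
lemma one_step_into:
  assumes "y \<in> {0..1}" "X \<subseteq> open_unit" "open Z" "Z \<noteq> {}" "Z \<subseteq> open_unit"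
  obtains u g w Q y' where "inverse_branch 1 X Q u g w" "open Q" "Q \<noteq> {}" "Q \<subseteq> Z"
    "y' \<in> {0..1}" "g y' = y"
proof -
  consider "y \<le> 2/3" "Z \<inter> {0<..<1/2} \<noteq> {}" | "y \<le> 2/3" "Z \<inter> {1/2<..<1} \<noteq> {}"
    | "2/3 \<le> y" "y \<le> 5/6" | "5/6 \<le> y"
    using open_minus_half[OF assms(3-5)] by linarith
  then show ?thesis
  proof cases
    case 1
    show ?thesis
      by (rule that[OF inverse_branch_mono[OF inverse_branch_A assms(2)], of "Z \<inter> {0<..<1/2}" "3/2 * y"])
         (use assms 1 in auto)
  next
    case 2
    show ?thesis
      by (rule that[OF inverse_branch_mono[OF inverse_branch_D assms(2)], of "Z \<inter> {1/2<..<1}" "3/2 * y"])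
         (use assms 2 in auto)
  next
    case 3
    show ?thesis
      by (rule that[OF inverse_branch_mono[OF inverse_branch_B assms(2,5)], of "6 * y - 4"])
         (use assms 3 in \<open>auto simp: field_simps\<close>)
  next
    case 4
    show ?thesis
      by (rule that[OF inverse_branch_mono[OF inverse_branch_C assms(2,5)], of "6 * y - 5"])
         (use assms 4 in \<open>auto simp: field_simps\<close>)
  qed
qed

text \<open>Iterating the previous lemma backwards in time. The contraction \<open>g\<close> has slope at most
  \<open>(2/3) ^ n\<close>, so its image determines the height up to a small error.\<close>
lemma prescribe_y:
  assumes "y \<in> {0..1}" "open X" "X \<noteq> {}" "X \<subseteq> open_unit" "open Z" "Z \<noteq> {}" "Z \<subseteq> open_unit"
  shows "\<exists>u g w Q. inverse_branch n X Q u g w \<and> open Q \<and> Q \<noteq> {} \<and> Q \<subseteq> Z \<and> y \<in> g ` {0..1}"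
  using assms
proof (induction n arbitrary: y X Z)
  case 0
  then show ?case
    using inverse_branch_id[of X Z] by (metis image_id id_apply order_refl)
next
  case (Suc n)
  obtain u g w Q y' where last: "inverse_branch 1 X Q u g w" "open Q" "Q \<noteq> {}" "Q \<subseteq> Z"
    "y' \<in> {0..1}" "g y' = y"
    using one_step_into[of y X Z] Suc.prems by metis
  note D = inverse_branchD[OF last(1)]
  obtain k where k: "has_slope w k"
    using D(3) by blast
  have "open (u ` X)" "open (w ` Q)"
    using has_slope_open_image D(1) k Suc.prems(2) last(2) by blast+
  then obtain u' g' w' Q' where before: "inverse_branch n (u ` X) Q' u' g' w'" "open Q'"
    "Q' \<noteq> {}" "Q' \<subseteq> w ` Q" "y' \<in> g' ` {0..1}"
    using Suc.IH[OF last(5) _ _ D(6) _ _ D(7)] last(3) Suc.prems(3) by blast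
  have "inverse_branch (n + 1) X (Q \<inter> w -` Q') (u' \<circ> u) (g \<circ> g') (w' \<circ> w)"
    by (rule inverse_branch_compose[OF before(1) inverse_branch_mono[OF last(1)]]) auto
  moreover have "open (Q \<inter> w -` Q')"
    using last(2) before(2) k has_slope_open_vimage by blast
  moreover have "Q \<inter> w -` Q' \<noteq> {}" "Q \<inter> w -` Q' \<subseteq> Z"
    using before(3,4) last(4) by blast+
  moreover have "y \<in> (g \<circ> g') ` {0..1}"
    using before(5) last(6) by auto
  ultimately show ?case
    by (metis Suc_eq_plus1)
qed

text \<open>The first step from \<open>x\<close> is forced by \<open>x\<close> up to the choice between \<open>B\<close> and \<open>C\<close>, which is made
  by the digit of \<open>z\<close> on top of the stack; any digit occurring in \<open>Z\<close> may be used.\<close>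
lemma one_step_from:
  assumes "x \<in> {0..1}" "open Z" "Z \<noteq> {}" "Z \<subseteq> open_unit"
  obtains (found) u g w Q Q' x' where "inverse_branch 1 open_unit Q u g w" "open Q'" "Q' \<noteq> {}" "Q' \<subseteq> Q"
    "w ` Q' \<subseteq> Z" "x' \<in> {0..1}" "u x' = x"
proof -
  have step: thesis
    if b: "inverse_branch 1 open_unit Q u g w" "z \<in> Q" "w z \<in> Z" "open Q"
      "x' \<in> {0..1}" "u x' = x" for u g w Q z x'
  proof -
    obtain k where "has_slope w k"
      using inverse_branchD(3)[OF b(1)] by blast
    then have "open (Q \<inter> w -` Z)"
      using b(4) assms(2) has_slope_open_vimage by blast
    moreover have "Q \<inter> w -` Z \<noteq> {}"
      using b(2,3) by blast
    ultimately show thesis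
      using found[OF b(1), of "Q \<inter> w -` Z" x'] b(5,6) by blast
  qed
  consider "x \<le> 1/3" | "1/3 \<le> x" "x \<le> 2/3" | "2/3 \<le> x" "Z \<inter> {0<..<1/2} \<noteq> {}"
    | "2/3 \<le> x" "Z \<inter> {1/2<..<1} \<noteq> {}"
    using open_minus_half[OF assms(2-4)] by linarith
  then show ?thesis
  proof cases
    case 1
    obtain z where "z \<in> Z" using assms by blast
    then show ?thesis
      using step[OF inverse_branch_A, of "z / 2" "3 * x"] assms 1 by auto
  next
    case 2
    obtain z where "z \<in> Z" using assms by blast
    then show ?thesis
      using step[OF inverse_branch_D, of "z / 2 + 1 / 2" "3 * x - 1"] assms 2 by auto
  next
    case 3
    then obtain z where "z \<in> Z" "0 < z" "z < 1/2" by auto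
    then show ?thesis
      using step[OF inverse_branch_B, of "2 * z" "3 * x - 2"] assms 3 by auto
  next
    case 4
    then obtain z where "z \<in> Z" "1/2 < z" "z < 1" by auto
    then show ?thesis
      using step[OF inverse_branch_C, of "2 * z - 1" "3 * x - 2"] assms 4 by auto
  qed
qed

text \<open>Iterating the previous lemma forwards in time: a ternary interval of rank \<open>n\<close> at \<open>x\<close> is stretched
  over the whole unit interval, while some open set of \<open>z\<close> survives.\<close>
lemma prescribe_x:
  assumes "x \<in> {0..1}" "open Z" "Z \<noteq> {}" "Z \<subseteq> open_unit"
  shows "\<exists>u g w Q. inverse_branch n open_unit Q u g w \<and> open Q \<and> Q \<noteq> {} \<and> w ` Q \<subseteq> Z \<and>
           x \<in> u ` {0..1}"
  using assms
proof (induction n arbitrary: x Z)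
  case 0
  then show ?case
    using inverse_branch_id[of open_unit Z] by (metis image_id id_apply order_refl)
next
  case (Suc n)
  obtain u g w Q Q' x' where first: "inverse_branch 1 open_unit Q u g w" "open Q'" "Q' \<noteq> {}"
    "Q' \<subseteq> Q" "w ` Q' \<subseteq> Z" "x' \<in> {0..1}" "u x' = x"
    using one_step_from[of x Z] Suc.prems by metis
  have "Q' \<subseteq> open_unit"
    using inverse_branchD(5)[OF first(1)] first(4) by blast
  then obtain u' g' w' R where rest: "inverse_branch n open_unit R u' g' w'" "open R" "R \<noteq> {}"
    "w' ` R \<subseteq> Q'" "x' \<in> u' ` {0..1}"
    using Suc.IH[of x' Q'] first by metis
  have "inverse_branch (1 + n) open_unit R (u \<circ> u') (g' \<circ> g) (w \<circ> w')"
    using inverse_branchD(6)[OF rest(1)] rest(4) first(4)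
    by (intro inverse_branch_compose[OF first(1) rest(1)]) auto
  moreover have "(w \<circ> w') ` R \<subseteq> Z" "x \<in> (u \<circ> u') ` {0..1}"
    using rest(4,5) first(5,7) by auto
  ultimately show ?case
    using rest(2,3) by (metis plus_1_eq_Suc)
qed

text \<open>Popping the first \<open>n\<close> binary digits of \<open>z\<close> stretches a dyadic interval of rank \<open>n\<close> over the
  whole unit interval.\<close>
lemma prescribe_z_by_popping:
  assumes "z \<in> {0..1}"
  shows "\<exists>u g w. inverse_branch n open_unit open_unit u g w \<and> has_slope w ((1/2) ^ n) \<and>
           z \<in> w ` {0..1}"
  using assms
proof (induction n arbitrary: z)
  case 0
  then show ?case
    using inverse_branch_id[of open_unit open_unit] has_slope_id
    by (metis image_id id_apply order_refl power_0)
next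
  case (Suc n)
  have step: ?case
    if "inverse_branch 1 open_unit open_unit u g w" "has_slope w (1/2)" "z' \<in> {0..1}" "w z' = z"
    for u g w z'
  proof -
    obtain u' g' w' where rest: "inverse_branch n open_unit open_unit u' g' w'"
      "has_slope w' ((1/2) ^ n)" "z' \<in> w' ` {0..1}"
      using Suc.IH[OF \<open>z' \<in> {0..1}\<close>] by blast
    have "inverse_branch (1 + n) open_unit open_unit (u \<circ> u') (g' \<circ> g) (w \<circ> w')"
      using inverse_branch_compose[OF that(1) rest(1)] inverse_branchD(6,7)[OF rest(1)] by blast
    moreover have "has_slope (w \<circ> w') ((1/2) ^ Suc n)"
      using has_slope_compose[OF that(2) rest(2)] by simp
    moreover have "z \<in> (w \<circ> w') ` {0..1}"
      using rest(3) that(4) by auto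
    ultimately show ?thesis
      by (metis plus_1_eq_Suc)
  qed
  show ?case
  proof (cases "z \<le> 1/2")
    case True
    then show ?thesis
      using Suc.prems by (intro step[OF inverse_branch_B, of "2 * z"]) (auto simp: has_slope_def)
  next
    case False
    then show ?thesis
      using Suc.prems
      by (intro step[OF inverse_branch_C, of "2 * z - 1"]) (auto simp: has_slope_def field_simps)
  qed
qed

text \<open>Pushing the first \<open>n\<close> binary digits of \<open>z\<close>, last digit first, squeezes the whole unit interval
  into a dyadic interval of rank \<open>n\<close> at \<open>z\<close>. The target of the branch is that dyadic interval,
  written as a preimage under the expanding map \<open>w\<close>.\<close>
lemma prescribe_z_by_pushing:
  assumes "z \<in> {0..1}"
  shows "\<exists>u g w. inverse_branch n open_unit (w -` open_unit) u g w \<and> has_slope w (2 ^ n) \<and>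
           w z \<in> {0..1}"
  using assms
proof (induction n arbitrary: z)
  case 0
  then show ?case
    using inverse_branch_id[of open_unit open_unit] has_slope_id
    by (metis vimage_id id_apply order_refl power_0)
next
  case (Suc n)
  have step: ?case
    if "inverse_branch 1 open_unit Q u g w" "w -` open_unit \<subseteq> Q" "has_slope w 2" "w z \<in> {0..1}"
    for u g w Q
  proof -
    obtain u' g' w' where before: "inverse_branch n open_unit (w' -` open_unit) u' g' w'"
      "has_slope w' (2 ^ n)" "w' (w z) \<in> {0..1}"
      using Suc.IH[OF \<open>w z \<in> {0..1}\<close>] by blast
    have "w' -` open_unit \<subseteq> open_unit"
      using inverse_branchD(5)[OF before(1)] .
    then have last: "inverse_branch 1 open_unit (w -` w' -` open_unit) u g w"
      using that(2) by (intro inverse_branch_mono[OF that(1)]) auto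
    then have "inverse_branch (n + 1) open_unit (w -` w' -` open_unit) (u' \<circ> u) (g \<circ> g') (w' \<circ> w)"
      using inverse_branchD(6)[OF last] by (intro inverse_branch_compose[OF before(1)]) auto
    moreover have "has_slope (w' \<circ> w) (2 ^ Suc n)"
      using has_slope_compose[OF before(2) that(3)] by (simp add: mult.commute)
    ultimately show ?thesis
      using before(3) unfolding vimage_comp Suc_eq_plus1 by (metis o_apply)
  qed
  show ?case
  proof (cases "z \<le> 1/2")
    case True
    then show ?thesis
      using Suc.prems by (intro step[OF inverse_branch_A]) (auto simp: has_slope_def)
  next
    case False
    then show ?thesis
      using Suc.prems by (intro step[OF inverse_branch_D]) (auto simp: has_slope_def)
  qed
qed

lemma open_real_around:
  fixes S :: "real set"
  assumes "open S" "x \<in> S"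
  obtains e where "e > 0" "{x - e<..<x + e} \<subseteq> S"
  using assms open_contains_ball[of S] by (auto simp: ball_eq_greaterThanLessThan)

lemma open_real_contains_interval:
  fixes S :: "real set"
  assumes "open S" "S \<noteq> {}"
  obtains a b where "a < b" "{a..b} \<subseteq> S"
proof -
  obtain x where "x \<in> S" using assms by blast
  then obtain e where e: "e > 0" "{x - e<..<x + e} \<subseteq> S"
    using open_real_around assms by metis
  then show ?thesis
    by (intro that[of "x - e/2" "x + e/2"]) auto
qed

text \<open>First the digits of \<open>x\<close> are used up, which may move \<open>z\<close> anywhere; then pops, for which \<open>x\<close> is
  free again, use up the digits of \<open>z\<close> that have become relevant.\<close>
lemma full_expansion:
  assumes "open X" "X \<noteq> {}" "open Z" "Z \<noteq> {}" "X \<subseteq> open_unit" "Z \<subseteq> open_unit"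
  obtains n u g w where "inverse_branch n open_unit open_unit u g w"
    "u ` open_unit \<subseteq> X" "w ` open_unit \<subseteq> Z"
proof -
  obtain x where x: "x \<in> X" using assms by blast
  then obtain e where e: "e > 0" "{x - e<..<x + e} \<subseteq> X"
    using open_real_around assms by metis
  obtain n where n: "(1/3) ^ n < e"
    using real_arch_pow_inv[of e "1/3"] e by auto
  have "x \<in> {0..1}" using x assms(5) by force
  then obtain u g w Q where 1: "inverse_branch n open_unit Q u g w" "open Q" "Q \<noteq> {}"
    "w ` Q \<subseteq> Z" "x \<in> u ` {0..1}"
    using prescribe_x[of x Z n] assms(3,4,6) by blast
  obtain z where z: "z \<in> Q" using 1(3) by blast
  then obtain e' where e': "e' > 0" "{z - e'<..<z + e'} \<subseteq> Q"
    using open_real_around 1(2) by metis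
  obtain m where m: "(1/2) ^ m < e'"
    using real_arch_pow_inv[of e' "1/2"] e' by auto
  have "z \<in> {0..1}" using z inverse_branchD(5)[OF 1(1)] by force
  then obtain u' g' w' where 2: "inverse_branch m open_unit open_unit u' g' w'"
    "has_slope w' ((1/2) ^ m)" "z \<in> w' ` {0..1}"
    using prescribe_z_by_popping[of z m] by blast
  have "u ` {0..1} \<subseteq> X"
    using has_slope_image_ball[OF inverse_branchD(1)[OF 1(1)] _ n] 1(5) e(2) by blast
  then have "u ` open_unit \<subseteq> X"
    by force
  then have "(u \<circ> u') ` open_unit \<subseteq> X"
    using inverse_branchD(6)[OF 2(1)] unfolding image_comp[symmetric] by blast
  moreover have "w' ` {0..1} \<subseteq> Q"
    using has_slope_image_ball[OF 2(2) _ m] 2(3) e'(2) by blast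
  then have w': "w' ` open_unit \<subseteq> Q"
    by force
  then have "(w \<circ> w') ` open_unit \<subseteq> Z"
    using 1(4) unfolding image_comp[symmetric] by blast
  moreover have "inverse_branch (n + m) open_unit open_unit (u \<circ> u') (g' \<circ> g) (w \<circ> w')"
    using inverse_branch_compose[OF 1(1) 2(1) inverse_branchD(6)[OF 2(1)] w'] .
  ultimately show ?thesis
    using that by blast
qed

section \<open>Fixed points of branches\<close>

text \<open>The number \<open>k\<close> is the slope of the inverse map, so the multiplier in the direction of \<open>z\<close> is
  \<open>1 / k\<close>.\<close>
definition branch_fixes :: "nat \<Rightarrow> real \<Rightarrow> real \<Rightarrow> real \<Rightarrow> real \<Rightarrow> bool" where
  "branch_fixes n k x y z \<longleftrightarrow>
     (\<exists>P Q u g w. inverse_branch n P Q u g w \<and> open P \<and> open Q \<and> has_slope w k \<and>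
        x \<in> P \<and> y \<in> {0..1} \<and> z \<in> Q \<and> u x = x \<and> g y = y \<and> w z = z)"

lemma has_slope_fixed_point_unit:
  assumes f: "has_slope f c" and "c < 1" "f ` {0..1} \<subseteq> {0..1}"
  shows "\<exists>y\<in>{0..1}. f y = y"
proof
  have "f 0 \<in> {0..1}" "f 1 \<in> {0..1}"
    using assms(3) by (simp_all add: image_subset_iff)
  then show "f 0 / (1 - c) \<in> {0..1}"
    using has_slopeD[OF f, of 1] assms(2) by (simp add: field_simps)
  show "f (f 0 / (1 - c)) = f 0 / (1 - c)"
    using has_slopeD[OF f, of "f 0 / (1 - c)"] assms(2) by (simp add: field_simps)
qed

lemma inverse_branch_fixed_y:
  assumes "inverse_branch n P Q u g w" "n \<ge> 1"
  shows "\<exists>y\<in>{0..1}. g y = y"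
proof -
  obtain r where r: "has_slope g r" "r \<le> (2/3) ^ n"
    using inverse_branchD(2)[OF assms(1)] by blast
  have "(2/3 :: real) ^ n \<le> (2/3) ^ 1"
    using assms(2) by (intro power_decreasing) auto
  then have "r < 1"
    using r(2) by simp
  then show ?thesis
    using has_slope_fixed_point_unit[OF r(1)] inverse_branchD(8)[OF assms(1)] by blast
qed

text \<open>Since \<open>g\<close> maps the whole unit interval into \<open>Y\<close>, the full column over a rectangle enters the
  box \<open>X \<times> Y \<times> Z\<close>.\<close>
lemma branch_into_box:
  assumes "open X" "X \<noteq> {}" "X \<subseteq> open_unit" "open Z" "Z \<noteq> {}" "Z \<subseteq> open_unit"
    and "open Y" "y\<^sub>0 \<in> Y" "y\<^sub>0 \<in> {0..1}"
  obtains m u g w Q where "m \<ge> 1" "inverse_branch m X Q u g w" "open Q" "Q \<noteq> {}" "Q \<subseteq> Z"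
    "g ` {0..1} \<subseteq> Y"
proof -
  obtain e where e: "e > 0" "{y\<^sub>0 - e<..<y\<^sub>0 + e} \<subseteq> Y"
    using open_real_around assms by metis
  obtain m where m: "(2/3) ^ m < min e 1"
    using real_arch_pow_inv[of "min e 1" "2/3"] e by auto
  then have "m \<ge> 1"
    by (cases m) auto
  obtain u g w Q where enter: "inverse_branch m X Q u g w" "open Q" "Q \<noteq> {}" "Q \<subseteq> Z"
    "y\<^sub>0 \<in> g ` {0..1}"
    using prescribe_y[of y\<^sub>0 X Z m] assms by metis
  obtain r where r: "has_slope g r" "r \<le> (2/3) ^ m"
    using inverse_branchD(2)[OF enter(1)] by blast
  have "g ` {0..1} \<subseteq> Y"
    using has_slope_image_ball[OF r(1), of _ e] r(2) m e(2) enter(5) by force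
  then show ?thesis
    using that \<open>m \<ge> 1\<close> enter(1-4) by blast
qed

text \<open>Let a branch of length \<open>m\<close> enter the box along \<open>X \<times> Q\<close>. From a rectangle compactly inside
  \<open>X \<times> Q\<close>, a full expansion of length \<open>l\<close> leads to the whole unit square, in particular to the
  domain of the entering branch. The composite sends a small rectangle onto one that contains its
  closure, so its inverse maps \<open>w' \<circ> w\<close> and \<open>u' \<circ> u\<close> are contractions with a fixed point: in
  forward time \<open>z\<close> is expanded. For the second type, between the expansion and the entering
  branch so many digits are pushed that \<open>z\<close> finally lands in an interval \<open>R\<close> whose
  closure lies in the interval \<open>J\<close> where it started, so that now \<open>z\<close> is contracted in forward time. In both cases the
  last portion is the entering branch, and this places the fixed \<open>y\<close> in \<open>Y\<close>.\<close>
lemma branch_fixed_points_of_both_types: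
  assumes "open X" "X \<noteq> {}" "X \<subseteq> open_unit" "open Z" "Z \<noteq> {}" "Z \<subseteq> open_unit"
    and "open Y" "y\<^sub>0 \<in> Y" "y\<^sub>0 \<in> {0..1}"
  shows "\<exists>n\<ge>1. \<exists>k<1. \<exists>x\<in>X. \<exists>y\<in>Y. \<exists>z\<in>Z. branch_fixes n k x y z"
    and "\<exists>n\<ge>1. \<exists>k>1. \<exists>x\<in>X. \<exists>y\<in>Y. \<exists>z\<in>Z. branch_fixes n k x y z"
proof -
  obtain m u g w Q where "m \<ge> 1" and enter: "inverse_branch m X Q u g w" "open Q" "Q \<noteq> {}" "Q \<subseteq> Z"
    and gY: "g ` {0..1} \<subseteq> Y"
    using branch_into_box[of X Z Y y\<^sub>0] assms by metis
  note De = inverse_branchD[OF enter(1)]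
  obtain k where k: "has_slope w k"
    using De(3) by blast
  obtain a b where ab: "a < b" "{a..b} \<subseteq> X"
    using open_real_contains_interval assms by metis
  obtain c d where cd: "c < d" "{c..d} \<subseteq> Q"
    using open_real_contains_interval enter by metis
  have "{a<..<b} \<subseteq> open_unit" "{c<..<d} \<subseteq> open_unit"
    using ab cd assms(3) De(5) greaterThanLessThan_subseteq_atLeastAtMost_iff[of a b a b]
      greaterThanLessThan_subseteq_atLeastAtMost_iff[of c d c d] by blast+
  then obtain l u' g' w' where full: "inverse_branch l open_unit open_unit u' g' w'"
    "u' ` open_unit \<subseteq> {a<..<b}" "w' ` open_unit \<subseteq> {c<..<d}"
    using full_expansion[of "{a<..<b}" "{c<..<d}" thesis] ab(1) cd(1) by simp
  note Df = inverse_branchD[OF full(1)]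
  obtain k' where k': "has_slope w' k'"
    using Df(3) by blast
  have fixed_x: "\<exists>x\<in>X. v x = x"
    if v: "has_slope v s" "a < v a" "v b < b" for v s
    using has_slope_fixed_point_contracting(2)[OF v(1) ab(1) v(2,3)] ab(2) by force
  have corners: "u a \<in> open_unit" "u b \<in> open_unit" "w c \<in> open_unit" "w d \<in> open_unit"
    using De(6,7) ab cd by (simp_all add: image_subset_iff subset_iff)

  show "\<exists>n\<ge>1. \<exists>k<1. \<exists>x\<in>X. \<exists>y\<in>Y. \<exists>z\<in>Z. branch_fixes n k x y z"
  proof -
    have br: "inverse_branch (l + m) X Q (u' \<circ> u) (g \<circ> g') (w' \<circ> w)"
      using inverse_branch_compose[OF full(1) enter(1) De(6,7)] .
    have ww: "has_slope (w' \<circ> w) (k' * k)"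
      using has_slope_compose k k' by blast
    have "a < (u' \<circ> u) a" "(u' \<circ> u) b < b" "c < (w' \<circ> w) c" "(w' \<circ> w) d < d"
      using corners full(2,3) by (simp_all add: image_subset_iff)
    then obtain x z where x: "x \<in> X" "(u' \<circ> u) x = x" and z: "z \<in> {c<..<d}" "(w' \<circ> w) z = z"
      and less: "k' * k < 1"
      using fixed_x[OF inverse_branchD(1)[OF br]] has_slope_fixed_point_contracting[OF ww cd(1)] by blast
    obtain y where y: "y \<in> {0..1}" "(g \<circ> g') y = y"
      using inverse_branch_fixed_y[OF br] \<open>m \<ge> 1\<close> by auto
    have "y \<in> Y"
      using y gY Df(8)[of y] by (metis comp_apply image_subset_iff)
    have "z \<in> Q"
      using z(1) cd(2) by force
    then have "branch_fixes (l + m) (k' * k) x y z"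
      unfolding branch_fixes_def using br assms(1) enter(2) ww x y z(2) by blast
    then show ?thesis
      using less x(1) \<open>y \<in> Y\<close> \<open>z \<in> Q\<close> enter(4) \<open>m \<ge> 1\<close> by (metis subsetD trans_le_add2)
  qed

  show "\<exists>n\<ge>1. \<exists>k>1. \<exists>x\<in>X. \<exists>y\<in>Y. \<exists>z\<in>Z. branch_fixes n k x y z"
  proof -
    define J where "J = w' ` open_unit"
    have "{c<..<d} \<subseteq> {c..d}"
      by auto
    then have J: "J \<subseteq> Q"
      using full(3) cd(2) unfolding J_def by (meson order_trans)
    have "open J"
      unfolding J_def by (rule has_slope_open_image[OF k' open_greaterThanLessThan])
    then have "open (w ` J)"
      by (rule has_slope_open_image[OF k])
    \<comment> \<open>Any point of the image of \<open>J\<close> would do as the place to squeeze \<open>z\<close> into.\<close>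
    define s where "s = w (w' (1/2))"
    have "s \<in> w ` J"
      unfolding s_def J_def by auto
    then obtain e' where e': "e' > 0" "{s - e'<..<s + e'} \<subseteq> w ` J"
      using open_real_around \<open>open (w ` J)\<close> by metis
    obtain j where j: "(1/2) ^ j < e'"
      using real_arch_pow_inv[of e' "1/2"] e' by auto
    have "s \<in> open_unit"
      using \<open>s \<in> w ` J\<close> De(7) J by blast
    then have "s \<in> {0..1}" by auto
    then obtain uc gc wc where con: "inverse_branch j open_unit (wc -` open_unit) uc gc wc"
      "has_slope wc (2 ^ j)" "wc s \<in> {0..1}"
      using prescribe_z_by_pushing[of s j] by blast
    note Dc = inverse_branchD[OF con(1)]
    obtain vc where vc: "has_slope vc (1 / 2 ^ j)" "\<And>x. wc (vc x) = x" "\<And>x. vc (wc x) = x"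
      using has_slope_inverse[OF con(2)] by blast
    obtain v where v: "has_slope v (1 / k)" "\<And>x. w (v x) = x" "\<And>x. v (w x) = x"
      using has_slope_inverse[OF k] by blast
    have "vc ` {0..1} \<subseteq> {s - e'<..<s + e'}"
      using has_slope_image_ball[OF vc(1) con(3), of e'] j by (simp add: vc(3) power_one_over)
    then have vcJ: "vc ` {0..1} \<subseteq> w ` J"
      using e'(2) by blast
    \<comment> \<open>The maps \<open>vc\<close> and \<open>v\<close> undo \<open>wc\<close> and \<open>w\<close>, so \<open>v (vc 0)\<close> and \<open>v (vc 1)\<close> are the ends of \<open>R\<close> below.\<close>
    have inJ: "v (vc t) \<in> J" if "t \<in> {0..1}" for t
    proof -
      have "vc t \<in> w ` J"
        using vcJ that by blast
      then show ?thesis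
        using v(3) by auto
    qed
    define R where "R = w -` wc -` open_unit"
    have "R \<subseteq> J"
    proof
      fix z assume "z \<in> R"
      then have "wc (w z) \<in> {0..1}"
        by (auto simp: R_def)
      from inJ[OF this] show "z \<in> J"
        by (simp add: v(3) vc(3))
    qed
    have "open R"
      unfolding R_def using has_slope_open_vimage k con(2) by (meson open_greaterThanLessThan)
    have before: "inverse_branch (l + j) open_unit (wc -` open_unit) (u' \<circ> uc) (gc \<circ> g') (w' \<circ> wc)"
      using Dc(6) by (intro inverse_branch_compose[OF full(1) con(1)]) auto
    have br: "inverse_branch (l + j + m) X R (u' \<circ> uc \<circ> u) (g \<circ> (gc \<circ> g')) (w' \<circ> wc \<circ> w)"
      using \<open>R \<subseteq> J\<close> J
      by (intro inverse_branch_compose[OF before] inverse_branch_mono[OF enter(1)] De(6))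
         (auto simp: R_def)
    have ww: "has_slope (w' \<circ> wc \<circ> w) (k' * 2 ^ j * k)"
      using has_slope_compose k k' con(2) by blast
    have ends: "(w' \<circ> wc \<circ> w) (v (vc t)) = w' t" for t
      by (simp add: v(2) vc(2))
    have below: "w' 0 < z" "z < w' 1" if "z \<in> J" for z
      using that has_slope_less_iff[OF k'] unfolding J_def by auto
    have "v (vc 0) < v (vc 1)"
      using has_slope_less_iff v(1) vc(1) by (metis zero_less_one)
    moreover have "(w' \<circ> wc \<circ> w) (v (vc 0)) < v (vc 0)" "v (vc 1) < (w' \<circ> wc \<circ> w) (v (vc 1))"
      unfolding ends using below inJ by auto
    ultimately obtain z where z: "z \<in> {v (vc 0)<..<v (vc 1)}" "(w' \<circ> wc \<circ> w) z = z"
      and greater: "k' * 2 ^ j * k > 1"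
      using has_slope_fixed_point_expanding[OF ww] by blast
    have "z = v (vc (wc (w z)))"
      by (simp add: v(3) vc(3))
    then have "wc (w z) \<in> open_unit"
      using z(1) has_slope_less_iff[OF v(1)] has_slope_less_iff[OF vc(1)]
      by (metis greaterThanLessThan_iff)
    then have "z \<in> R"
      by (simp add: R_def)
    have "a < (u' \<circ> uc \<circ> u) a" "(u' \<circ> uc \<circ> u) b < b"
      using corners(1,2) full(2) Dc(6) by (simp_all add: image_subset_iff)
    then obtain x where x: "x \<in> X" "(u' \<circ> uc \<circ> u) x = x"
      using fixed_x[OF inverse_branchD(1)[OF br]] by blast
    obtain y where y: "y \<in> {0..1}" "(g \<circ> (gc \<circ> g')) y = y"
      using inverse_branch_fixed_y[OF br] \<open>m \<ge> 1\<close> by auto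
    have "y \<in> Y"
      using y gY Df(8)[of y] Dc(8)[of "g' y"] by (metis comp_apply image_subset_iff)
    have "branch_fixes (l + j + m) (k' * 2 ^ j * k) x y z"
      unfolding branch_fixes_def using br assms(1) \<open>open R\<close> ww x y \<open>z \<in> R\<close> z(2) by blast
    moreover have "z \<in> Z"
      using \<open>z \<in> R\<close> \<open>R \<subseteq> J\<close> J enter(4) by blast
    ultimately show ?thesis
      using greater x(1) \<open>y \<in> Y\<close> \<open>m \<ge> 1\<close> by (metis trans_le_add2)
  qed
qed

section \<open>Multipliers of iterates with diagonal derivative\<close>

definition diagonal :: "('n \<Rightarrow> real) \<Rightarrow> real ^ 'n ^ 'n" where
  "diagonal d = (\<chi> i j. if i = j then d i else 0)"

lemma eigenvalues_diagonal:
  fixes d :: "'n::finite \<Rightarrow> real"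
  shows "eigenvalues (diagonal d) = image_mset (\<lambda>i. complex_of_real (d i)) (mset_set UNIV)"
proof -
  define A :: "complex poly ^ 'n ^ 'n"
    where "A = mat [:0, 1:] - (\<chi> i j. [:complex_of_real (diagonal d $ i $ j):])"
  have "det A = (\<Prod>i\<in>UNIV. A $ i $ i)"
    by (rule det_diagonal) (simp add: A_def mat_def diagonal_def)
  also have "\<dots> = (\<Prod>i\<in>UNIV. [:- complex_of_real (d i), 1:])"
    by (simp add: A_def mat_def diagonal_def)
  finally have "eigenvalues (diagonal d) = (\<Sum>i\<in>UNIV. {#complex_of_real (d i)#})"
    by (simp add: eigenvalues_def char_polynomial_def A_def proots_prod)
  also have "\<dots> = image_mset (\<lambda>i. complex_of_real (d i)) (mset_set UNIV)"
    by (rule sum_unfold_sum_mset[THEN trans]) (simp add: multiset.map_comp o_def)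
  finally show ?thesis .
qed

lemma unit_cube_eq_cbox: "(unit_cube :: (real ^ 'n::finite) set) = cbox 0 1"
  by (auto simp: unit_cube_def mem_box_cart)

text \<open>The fixed height of a branch may be 0 or 1, so periodic points on the boundary of the cube have to
  be admitted. Derivatives within a box of full dimension are unique there as well.\<close>
lemma diagonal_derivative:
  fixes f :: "real ^ 'n::finite \<Rightarrow> real ^ 'n"
  assumes "p \<in> unit_cube" "open S" "p \<in> S"
    and eq: "\<And>v i. v \<in> S \<Longrightarrow> v \<in> unit_cube \<Longrightarrow> f v $ i = p $ i + d i * (v $ i - p $ i)"
  shows "f differentiable (at p within unit_cube)"
    and "jacobian f (at p within unit_cube) = diagonal d"
proof -
  define L :: "real ^ 'n \<Rightarrow> real ^ 'n" where "L h = (\<chi> i. d i * h $ i)" for h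
  have L: "linear L"
    by (rule linearI) (simp_all add: L_def vec_eq_iff algebra_simps)
  then have "(L has_derivative L) (at p within unit_cube)"
    by (simp add: linear_imp_has_derivative)
  then have derL: "((\<lambda>v. L v + (p - L p)) has_derivative L) (at p within unit_cube)"
    by (rule has_derivative_add_const)
  obtain e where e: "e > 0" "ball p e \<subseteq> S"
    using assms(2,3) open_contains_ball by blast
  have der: "(f has_derivative L) (at p within unit_cube)"
  proof (rule has_derivative_transform_within[OF derL e(1) assms(1)])
    fix v assume v: "v \<in> unit_cube" "dist v p < e"
    then have "v \<in> S"
      using e(2) by (auto simp: dist_commute subset_iff)
    then show "L v + (p - L p) = f v"
      using eq[of v] v(1) by (simp add: L_def vec_eq_iff algebra_simps)
  qed
  then show diff: "f differentiable (at p within unit_cube)"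
    by (rule differentiableI)
  have "frechet_derivative f (at p within unit_cube) = L"
  proof (rule frechet_derivative_unique_within_closed_interval[of 0 1])
    show "(0 :: real ^ 'n) \<bullet> i < 1 \<bullet> i" if "i \<in> Basis" for i
      using that by (auto simp: Basis_vec_def inner_axis)
  qed (use assms(1) der diff[unfolded frechet_derivative_works] in \<open>simp_all add: unit_cube_eq_cbox\<close>)
  then show "jacobian f (at p within unit_cube) = diagonal d"
    by (simp add: jacobian_def matrix_def diagonal_def L_def vec_eq_iff axis_def)
qed

lemma unstable_hyperbolic_pointsI:
  fixes G :: "real ^ 'n::finite \<Rightarrow> real ^ 'n"
  assumes "p \<in> unit_cube" "n \<ge> 1" "(G ^^ n) p = p" "open S" "p \<in> S"
    and "\<And>v i. v \<in> S \<Longrightarrow> v \<in> unit_cube \<Longrightarrow> (G ^^ n) v $ i = p $ i + d i * (v $ i - p $ i)"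
    and "\<And>i. \<bar>d i\<bar> \<noteq> 1"
  shows "p \<in> unstable_hyperbolic_points unit_cube G (card {i. \<bar>d i\<bar> > 1})"
proof -
  have diff: "(G ^^ n) differentiable (at p within unit_cube)"
    and "jacobian (G ^^ n) (at p within unit_cube) = diagonal d"
    using diagonal_derivative[of p S "G ^^ n" d] assms by blast+
  then have m: "multipliers unit_cube G n p = image_mset (\<lambda>i. complex_of_real (d i)) (mset_set UNIV)"
    by (simp add: multipliers_def eigenvalues_diagonal)
  have "hyperbolic unit_cube G n p"
    using assms(7) by (simp add: hyperbolic_def m)
  moreover have "unstable_dim unit_cube G n p = card {i. \<bar>d i\<bar> > 1}"
    by (simp add: unstable_dim_def m filter_mset_image_mset)
  ultimately show ?thesis
    using assms(1-3) diff by (auto simp: unstable_hyperbolic_points_def periodic_point_def)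
qed

lemma dense_in_unit_cubeI:
  fixes S :: "(real ^ 'n::finite) set"
  assumes "\<And>V. open V \<Longrightarrow> V \<inter> box 0 1 \<noteq> {} \<Longrightarrow> V \<inter> (S \<inter> unit_cube) \<noteq> {}"
  shows "dense_in S unit_cube"
proof -
  have "box 0 1 \<subseteq> closure (S \<inter> unit_cube)"
    using assms by (fastforce simp: closure_iff_nhds_not_empty)
  moreover have "box (0 :: real ^ 'n) 1 \<noteq> {}"
    by (simp add: interval_ne_empty_cart)
  ultimately show ?thesis
    using closure_minimal[of "box 0 1" "closure (S \<inter> unit_cube)"] closure_box[of "0 :: real ^ 'n" 1]
    by (simp add: dense_in_def unit_cube_eq_cbox)
qed

section \<open>Periodic points of both unstable dimensions are dense\<close>

lemma F_3D_image_unit_cube: "v \<in> unit_cube \<Longrightarrow> F_3D v \<in> unit_cube"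
proof -
  have "tau x \<in> {0..1}" for x
    using frac_ge_0[of "3 * x"] frac_lt_1[of "3 * x"] by (auto simp: tau_def)
  then show "v \<in> unit_cube \<Longrightarrow> F_3D v \<in> unit_cube"
    by (auto simp: unit_cube_def F_3D_def Let_def A_reg_def B_reg_def C_reg_def D_reg_def forall_3)
qed

lemma F_3D_funpow_unit_cube: "v \<in> unit_cube \<Longrightarrow> (F_3D ^^ n) v \<in> unit_cube"
  by (induction n) (simp_all add: F_3D_image_unit_cube)

lemma proj_xz_unit_cube: "v \<in> unit_cube \<Longrightarrow> proj_xz v \<in> unit_cube"
  by (simp add: unit_cube_def proj_xz_def forall_3 forall_2)

lemma F_2D_proj_xz: "v \<in> unit_cube \<Longrightarrow> F_2D (proj_xz v) = proj_xz (F_3D v)"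
  by (auto simp: unit_cube_def F_2D_def proj_xz_def F_3D_def Let_def A_reg_def B_reg_def C_reg_def
      D_reg_def forall_3)

lemma F_2D_funpow_proj_xz: "v \<in> unit_cube \<Longrightarrow> (F_2D ^^ n) (proj_xz v) = proj_xz ((F_3D ^^ n) v)"
  by (induction n) (simp_all add: F_2D_proj_xz F_3D_funpow_unit_cube)

text \<open>Around a point fixed by an inverse branch, the iterate is the affine map whose slopes in \<open>x\<close>
  and \<open>z\<close> are the reciprocals of those of the inverse maps.\<close>
lemma branch_fixes_affine:
  assumes "branch_fixes n k x y z" "n \<ge> 1"
  obtains r P Q where "0 < r" "r < 1" "(vector [x, y, z] :: real ^ 3) \<in> unit_cube"
    "open P" "open Q" "x \<in> P" "z \<in> Q"
    "\<And>v. v \<in> unit_cube \<Longrightarrow> v $ 1 \<in> P \<Longrightarrow> v $ 3 \<in> Q \<Longrightarrow> (F_3D ^^ n) v =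
       vector [x + 3 ^ n * (v $ 1 - x), y + r * (v $ 2 - y), z + 1 / k * (v $ 3 - z)]"
proof -
  obtain P Q u g w where br: "inverse_branch n P Q u g w" and w: "has_slope w k"
    and PQ: "open P" "open Q" and x: "x \<in> P" "u x = x" and y: "y \<in> {0..1}" "g y = y"
    and z: "z \<in> Q" "w z = z"
    using assms(1) unfolding branch_fixes_def by blast
  note D = inverse_branchD[OF br]
  obtain r where r: "has_slope g r" "r \<le> (2/3) ^ n"
    using D(2) by blast
  have "(2/3 :: real) ^ n \<le> (2/3) ^ 1"
    using assms(2) by (intro power_decreasing) auto
  then have "0 < r" "r < 1"
    using r(2) has_slope_pos[OF r(1)] by simp_all
  moreover have "x \<in> open_unit" "z \<in> open_unit"
    using D(4,5) x z by blast+
  then have "(vector [x, y, z] :: real ^ 3) \<in> unit_cube"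
    using y by (simp add: unit_cube_def forall_3)
  moreover have "open (u ` P)" "open (w ` Q)" "x \<in> u ` P" "z \<in> w ` Q"
    using has_slope_open_image D(1) w PQ x z by (blast, blast, metis imageI, metis imageI)
  moreover have "(F_3D ^^ n) v = vector [x + 3 ^ n * (v $ 1 - x), y + r * (v $ 2 - y), z + 1 / k * (v $ 3 - z)]"
    if v: "v \<in> unit_cube" "v $ 1 \<in> u ` P" "v $ 3 \<in> w ` Q" for v
  proof -
    obtain x' z' where x': "x' \<in> P" "v $ 1 = u x'" and z': "z' \<in> Q" "v $ 3 = w z'"
      using v by blast
    have v2: "v $ 2 \<in> {0..1}"
      using v(1) by (simp add: unit_cube_def)
    have "v = vector [u x', v $ 2, w z']"
      using x' z' by (simp add: vec_eq_iff forall_3)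
    then have F: "(F_3D ^^ n) v = vector [x', g (v $ 2), z']"
      using D(9)[OF x'(1) v2 z'(1)] by simp
    have "v $ 1 - x = (1/3) ^ n * (x' - x)" "v $ 3 - z = k * (z' - z)" "g (v $ 2) - y = r * (v $ 2 - y)"
      using has_slope_diff[OF D(1), of x' x] has_slope_diff[OF w, of z' z]
        has_slope_diff[OF r(1), of "v $ 2" y] x(2) y(2) z(2) x'(2) z'(2) by simp_all
    then have "x' = x + 3 ^ n * (v $ 1 - x)" "z' = z + 1 / k * (v $ 3 - z)" "g (v $ 2) = y + r * (v $ 2 - y)"
      using has_slope_pos[OF w] by (simp_all add: power_one_over)
    then show ?thesis
      using F by simp
  qed
  ultimately show ?thesis
    by (rule that)
qed

lemma open_cube_contains_box:
  fixes V :: "(real ^ 3) set"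
  assumes "open V" "V \<inter> box 0 1 \<noteq> {}"
  obtains X Y Z y\<^sub>0 where "open X" "X \<noteq> {}" "X \<subseteq> open_unit" "open Z" "Z \<noteq> {}" "Z \<subseteq> open_unit"
    "open Y" "y\<^sub>0 \<in> Y" "y\<^sub>0 \<in> {0..1}"
    "\<And>x y z. x \<in> X \<Longrightarrow> y \<in> Y \<Longrightarrow> z \<in> Z \<Longrightarrow> vector [x, y, z] \<in> V"
proof -
  obtain p where p: "p \<in> V" "p \<in> box 0 1"
    using assms(2) by blast
  then obtain e where e: "e > 0" "ball p e \<subseteq> V"
    using assms(1) open_contains_ball by blast
  define N where "N i = {p $ i - e / 3<..<p $ i + e / 3}" for i
  have unit: "p $ i \<in> open_unit" for i
    using p(2) by (simp add: mem_box_cart)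
  have N: "open (N i)" "p $ i \<in> N i" for i
    using e(1) by (simp_all add: N_def)
  have "vector [x, y, z] \<in> V" if "x \<in> N 1" "y \<in> N 2" "z \<in> N 3" for x y z
  proof -
    have "norm (p - vector [x, y, z]) \<le> (\<Sum>i\<in>UNIV. \<bar>(p - vector [x, y, z]) $ i\<bar>)"
      by (rule norm_le_l1_cart)
    also have "\<dots> < e"
      using that by (simp add: sum_3 N_def abs_if)
    finally show ?thesis
      using e(2) by (auto simp: dist_norm)
  qed
  moreover have "N i \<inter> open_unit \<noteq> {}" for i
    using N(2) unit by blast
  moreover have "p $ 2 \<in> {0..1}"
    using unit[of 2] by simp
  ultimately show ?thesis
    using N by (intro that[of "N 1 \<inter> open_unit" "N 3 \<inter> open_unit" "N 2" "p $ 2"]) auto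
qed

text \<open>The multiplier in \<open>x\<close> is always unstable and the one in \<open>y\<close> never is, so \<open>k\<close> decides.\<close>
lemma unstable_hyperbolic_point_3D:
  assumes "branch_fixes n k x y z" "n \<ge> 1" "k \<noteq> 1"
  shows "vector [x, y, z] \<in> unstable_hyperbolic_points unit_cube F_3D (if k < 1 then 2 else 1)"
proof -
  have "k > 0"
    using assms(1) has_slope_pos unfolding branch_fixes_def by blast
  obtain r P Q where r: "0 < r" "r < 1" and p: "(vector [x, y, z] :: real ^ 3) \<in> unit_cube"
    and PQ: "open P" "open Q" "x \<in> P" "z \<in> Q"
    and F: "\<And>v. v \<in> unit_cube \<Longrightarrow> v $ 1 \<in> P \<Longrightarrow> v $ 3 \<in> Q \<Longrightarrow> (F_3D ^^ n) v =
      vector [x + 3 ^ n * (v $ 1 - x), y + r * (v $ 2 - y), z + 1 / k * (v $ 3 - z)]"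
    by (rule branch_fixes_affine[OF assms(1,2)]) (rule that)
  define d :: "3 \<Rightarrow> real" where "d i = (if i = 1 then 3 ^ n else if i = 2 then r else 1 / k)" for i
  define S :: "(real ^ 3) set" where "S = ((\<lambda>v. v $ 1) -` P) \<inter> ((\<lambda>v. v $ 3) -` Q)"
  have "(3 :: real) ^ n > 1"
    using assms(2) by (intro one_less_power) auto
  then have d: "\<bar>d 1\<bar> > 1" "\<not> \<bar>d 2\<bar> > 1" "\<bar>d 2\<bar> \<noteq> 1" "\<bar>d 3\<bar> > 1 \<longleftrightarrow> k < 1" "\<bar>d 3\<bar> \<noteq> 1"
    using r \<open>k > 0\<close> \<open>k \<noteq> 1\<close> by (simp_all add: d_def field_simps)
  have "vector [x, y, z] \<in> unstable_hyperbolic_points unit_cube F_3D (card {i. \<bar>d i\<bar> > 1})"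
  proof (rule unstable_hyperbolic_pointsI[OF p assms(2), where S = S])
    show "(F_3D ^^ n) (vector [x, y, z]) = vector [x, y, z]"
      using F[OF p] PQ by simp
    show "open S"
      unfolding S_def using PQ by (intro open_Int open_vimage_vec_nth)
    show "\<bar>d i\<bar> \<noteq> 1" for i
      using d exhaust_3[of i] by auto
    show "(F_3D ^^ n) v $ i = vector [x, y, z] $ i + d i * (v $ i - vector [x, y, z] $ i)"
      if "v \<in> S" "v \<in> unit_cube" for v i
      using F[of v] that exhaust_3[of i] by (auto simp: S_def d_def)
  qed (use PQ in \<open>simp add: S_def\<close>)
  moreover have "{i. \<bar>d i\<bar> > 1} = (if k < 1 then {1, 3} else {1})"
    using d by (cases "k < 1") (simp_all add: set_eq_iff forall_3)
  then have "card {i. \<bar>d i\<bar> > 1} = (if k < 1 then 2 else 1)"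
    by simp
  ultimately show ?thesis
    by simp
qed

lemma unstable_hyperbolic_point_2D:
  assumes "branch_fixes n k x y z" "n \<ge> 1" "k \<noteq> 1"
  shows "vector [x, z] \<in> unstable_hyperbolic_points unit_cube F_2D (if k < 1 then 2 else 1)"
proof -
  have "k > 0"
    using assms(1) has_slope_pos unfolding branch_fixes_def by blast
  obtain r P Q where "0 < r" "r < 1" and p: "(vector [x, y, z] :: real ^ 3) \<in> unit_cube"
    and PQ: "open P" "open Q" "x \<in> P" "z \<in> Q"
    and F: "\<And>v. v \<in> unit_cube \<Longrightarrow> v $ 1 \<in> P \<Longrightarrow> v $ 3 \<in> Q \<Longrightarrow> (F_3D ^^ n) v =
      vector [x + 3 ^ n * (v $ 1 - x), y + r * (v $ 2 - y), z + 1 / k * (v $ 3 - z)]"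
    by (rule branch_fixes_affine[OF assms(1,2)]) (rule that)
  have F2: "(F_2D ^^ n) v = vector [x + 3 ^ n * (v $ 1 - x), z + 1 / k * (v $ 2 - z)]"
    if "v \<in> unit_cube" "v $ 1 \<in> P" "v $ 2 \<in> Q" for v
  proof -
    define v' :: "real ^ 3" where "v' = vector [v $ 1, 0, v $ 2]"
    have v': "v' \<in> unit_cube" "proj_xz v' = v"
      using that(1) by (simp_all add: v'_def unit_cube_def proj_xz_def vec_eq_iff forall_2 forall_3)
    then show ?thesis
      using F_2D_funpow_proj_xz[OF v'(1), of n] F[OF v'(1)] that(2,3)
      by (simp add: v'_def proj_xz_def)
  qed
  define d :: "2 \<Rightarrow> real" where "d i = (if i = 1 then 3 ^ n else 1 / k)" for i
  define S :: "(real ^ 2) set" where "S = ((\<lambda>v. v $ 1) -` P) \<inter> ((\<lambda>v. v $ 2) -` Q)"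
  have "(3 :: real) ^ n > 1"
    using assms(2) by (intro one_less_power) auto
  then have d: "\<bar>d 1\<bar> > 1" "\<bar>d 2\<bar> > 1 \<longleftrightarrow> k < 1" "\<bar>d 2\<bar> \<noteq> 1"
    using \<open>k > 0\<close> \<open>k \<noteq> 1\<close> by (simp_all add: d_def field_simps)
  have p2: "(vector [x, z] :: real ^ 2) \<in> unit_cube"
    using proj_xz_unit_cube[OF p] by (simp add: proj_xz_def)
  have "vector [x, z] \<in> unstable_hyperbolic_points unit_cube F_2D (card {i. \<bar>d i\<bar> > 1})"
  proof (rule unstable_hyperbolic_pointsI[OF p2 assms(2), where S = S])
    show "(F_2D ^^ n) (vector [x, z]) = vector [x, z]"
      using F2[OF p2] PQ by simp
    show "open S"
      unfolding S_def using PQ by (intro open_Int open_vimage_vec_nth)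
    show "\<bar>d i\<bar> \<noteq> 1" for i
      using d exhaust_2[of i] by auto
    show "(F_2D ^^ n) v $ i = vector [x, z] $ i + d i * (v $ i - vector [x, z] $ i)"
      if "v \<in> S" "v \<in> unit_cube" for v i
      using F2[of v] that exhaust_2[of i] by (auto simp: S_def d_def)
  qed (use PQ in \<open>simp add: S_def\<close>)
  moreover have "{i. \<bar>d i\<bar> > 1} = (if k < 1 then {1, 2} else {1})"
    using d by (cases "k < 1") (simp_all add: set_eq_iff forall_2)
  then have "card {i. \<bar>d i\<bar> > 1} = (if k < 1 then 2 else 1)"
    by simp
  ultimately show ?thesis
    by simp
qed

lemma branch_fixed_points_dense:
  fixes V :: "(real ^ 3) set"
  assumes "open V" "V \<inter> box 0 1 \<noteq> {}" "m \<in> {1, 2 :: nat}"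
  shows "\<exists>n k x y z. branch_fixes n k x y z \<and> n \<ge> 1 \<and> k \<noteq> 1 \<and> (if k < 1 then 2 else 1) = m \<and>
           vector [x, y, z] \<in> V"
proof -
  obtain X Y Z y\<^sub>0 where box: "open X" "X \<noteq> {}" "X \<subseteq> open_unit" "open Z" "Z \<noteq> {}" "Z \<subseteq> open_unit"
    "open Y" "y\<^sub>0 \<in> Y" "y\<^sub>0 \<in> {0..1}"
    and V: "\<And>x y z. x \<in> X \<Longrightarrow> y \<in> Y \<Longrightarrow> z \<in> Z \<Longrightarrow> vector [x, y, z] \<in> V"
    by (rule open_cube_contains_box[OF assms(1,2)]) (rule that)
  show ?thesis
  proof (cases "m = 2")
    case True
    obtain n k x y z where "n \<ge> 1" "k < 1" "branch_fixes n k x y z" "x \<in> X" "y \<in> Y" "z \<in> Z"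
      using branch_fixed_points_of_both_types(1)[OF box] by blast
    then show ?thesis
      using True V by (intro exI[of _ n] exI[of _ k] exI[of _ x] exI[of _ y] exI[of _ z]) simp
  next
    case False
    obtain n k x y z where "n \<ge> 1" "k > 1" "branch_fixes n k x y z" "x \<in> X" "y \<in> Y" "z \<in> Z"
      using branch_fixed_points_of_both_types(2)[OF box] by blast
    then show ?thesis
      using False assms(3) V
      by (intro exI[of _ n] exI[of _ k] exI[of _ x] exI[of _ y] exI[of _ z]) simp
  qed
qed

lemma unstable_points_dense_3D:
  assumes "m \<in> {1, 2}"
  shows "dense_in (unstable_hyperbolic_points unit_cube F_3D m) unit_cube"
proof (rule dense_in_unit_cubeI)
  fix V :: "(real ^ 3) set" assume V: "open V" "V \<inter> box 0 1 \<noteq> {}"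
  obtain n k x y z where "branch_fixes n k x y z" "n \<ge> 1" "k \<noteq> 1" "(if k < 1 then 2 else 1) = m"
    and p: "vector [x, y, z] \<in> V"
    using branch_fixed_points_dense[OF V assms] by blast
  then have "(vector [x, y, z] :: real ^ 3) \<in> unstable_hyperbolic_points unit_cube F_3D m"
    using unstable_hyperbolic_point_3D by blast
  moreover have "unstable_hyperbolic_points unit_cube F_3D m \<subseteq> unit_cube"
    by (auto simp: unstable_hyperbolic_points_def periodic_point_def)
  ultimately show "V \<inter> (unstable_hyperbolic_points unit_cube F_3D m \<inter> unit_cube) \<noteq> {}"
    using p by blast
qed

lemma open_proj_xz_vimage:
  assumes "open U" "U \<inter> box 0 1 \<noteq> {}"
  shows "open (proj_xz -` U)" "proj_xz -` U \<inter> box 0 1 \<noteq> {}"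
proof -
  have "linear proj_xz"
    by (rule linearI) (simp_all add: proj_xz_def vec_eq_iff forall_2)
  then show "open (proj_xz -` U)"
    using assms(1) by (intro open_vimage linear_continuous_on) (simp_all add: linear_conv_bounded_linear)
  obtain v where v: "v \<in> U" "v \<in> box 0 1"
    using assms(2) by blast
  define v' :: "real ^ 3" where "v' = vector [v $ 1, 1/2, v $ 2]"
  have "proj_xz v' = v"
    by (simp add: v'_def proj_xz_def vec_eq_iff forall_2)
  moreover have "v' \<in> box 0 1"
    using v(2) by (simp add: v'_def mem_box_cart forall_2 forall_3)
  ultimately have "v' \<in> proj_xz -` U \<inter> box 0 1"
    using v(1) by simp
  then show "proj_xz -` U \<inter> box 0 1 \<noteq> {}"
    by blast
qed

lemma unstable_points_dense_2D:
  assumes "m \<in> {1, 2}"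
  shows "dense_in (unstable_hyperbolic_points unit_cube F_2D m) unit_cube"
proof (rule dense_in_unit_cubeI)
  fix U :: "(real ^ 2) set" assume U: "open U" "U \<inter> box 0 1 \<noteq> {}"
  obtain n k x y z where "branch_fixes n k x y z" "n \<ge> 1" "k \<noteq> 1" "(if k < 1 then 2 else 1) = m"
    and p: "vector [x, y, z] \<in> proj_xz -` U"
    using branch_fixed_points_dense[OF open_proj_xz_vimage[OF U] assms] by blast
  then have "(vector [x, z] :: real ^ 2) \<in> unstable_hyperbolic_points unit_cube F_2D m"
    using unstable_hyperbolic_point_2D by blast
  moreover have "unstable_hyperbolic_points unit_cube F_2D m \<subseteq> unit_cube"
    by (auto simp: unstable_hyperbolic_points_def periodic_point_def)
  moreover have "vector [x, z] \<in> U"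
    using p by (simp add: proj_xz_def)
  ultimately show "U \<inter> (unstable_hyperbolic_points unit_cube F_2D m \<inter> unit_cube) \<noteq> {}"
    by blast
qed

section \<open>A dense orbit\<close>

text \<open>Stretch a subrectangle of \<open>X \<times> Z\<close> over the whole square, then follow a branch that takes the full
  column over some rectangle into \<open>V\<close>.\<close>
lemma columns_reach:
  fixes V :: "(real ^ 3) set"
  assumes "open V" "V \<inter> box 0 1 \<noteq> {}"
    and "open X" "X \<noteq> {}" "X \<subseteq> open_unit" "open Z" "Z \<noteq> {}" "Z \<subseteq> open_unit"
  obtains X' Z' n where "open X'" "X' \<noteq> {}" "X' \<subseteq> X" "open Z'" "Z' \<noteq> {}" "Z' \<subseteq> Z"
    "\<And>x y z. x \<in> X' \<Longrightarrow> y \<in> {0..1} \<Longrightarrow> z \<in> Z' \<Longrightarrow> (F_3D ^^ n) (vector [x, y, z]) \<in> V"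
proof -
  obtain X0 Y Z0 y\<^sub>0 where box: "open X0" "X0 \<noteq> {}" "X0 \<subseteq> open_unit" "open Z0" "Z0 \<noteq> {}"
    "Z0 \<subseteq> open_unit" "open Y" "y\<^sub>0 \<in> Y" "y\<^sub>0 \<in> {0..1}"
    and V: "\<And>x y z. x \<in> X0 \<Longrightarrow> y \<in> Y \<Longrightarrow> z \<in> Z0 \<Longrightarrow> vector [x, y, z] \<in> V"
    by (rule open_cube_contains_box[OF assms(1,2)]) (rule that)
  obtain m u g w Q where enter: "inverse_branch m X0 Q u g w" "open Q" "Q \<noteq> {}" "Q \<subseteq> Z0"
    "g ` {0..1} \<subseteq> Y"
    using branch_into_box[OF box] by metis
  note De = inverse_branchD[OF enter(1)]
  obtain l u' g' w' where full: "inverse_branch l open_unit open_unit u' g' w'"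
    "u' ` open_unit \<subseteq> X" "w' ` open_unit \<subseteq> Z"
    by (rule full_expansion[OF assms(3,4,6,7,5,8)]) (rule that)
  have br: "inverse_branch (l + m) X0 Q (u' \<circ> u) (g \<circ> g') (w' \<circ> w)"
    using inverse_branch_compose[OF full(1) enter(1) De(6,7)] .
  note D = inverse_branchD[OF br]
  obtain k where k: "has_slope (w' \<circ> w) k"
    using D(3) by blast
  show ?thesis
  proof
    show "open ((u' \<circ> u) ` X0)" "open ((w' \<circ> w) ` Q)"
      using has_slope_open_image D(1) k box(1) enter(2) by blast+
    show "(u' \<circ> u) ` X0 \<noteq> {}" "(w' \<circ> w) ` Q \<noteq> {}"
      using box(2) enter(3) by blast+
    show "(u' \<circ> u) ` X0 \<subseteq> X" "(w' \<circ> w) ` Q \<subseteq> Z"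
      using full(2,3) De(6,7) unfolding image_comp[symmetric] by blast+
    fix x y z :: real assume "x \<in> (u' \<circ> u) ` X0" "y \<in> {0..1}" "z \<in> (w' \<circ> w) ` Q"
    then obtain x' z' where x': "x' \<in> X0" "x = (u' \<circ> u) x'" and z': "z' \<in> Q" "z = (w' \<circ> w) z'"
      by blast
    have "(F_3D ^^ (l + m)) (vector [x, y, z]) = vector [x', (g \<circ> g') y, z']"
      using D(9)[OF x'(1) \<open>y \<in> {0..1}\<close> z'(1)] x'(2) z'(2) by simp
    moreover have "(g \<circ> g') y \<in> Y"
      using inverse_branchD(8)[OF full(1) \<open>y \<in> {0..1}\<close>] enter(5) unfolding o_apply by blast
    moreover have "z' \<in> Z0"
      using z'(1) enter(4) by blast
    ultimately show "(F_3D ^^ (l + m)) (vector [x, y, z]) \<in> V"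
      using V x'(1) by simp
  qed
qed

text \<open>The iterates of \<open>F_3D\<close> are discontinuous, so the set of points whose orbit enters an open set
  \<open>V\<close> need not be open. Baire's theorem is therefore applied to the union \<open>visits V\<close> of those open
  rectangles on which one common iterate leads into \<open>V\<close>; it is dense by the previous lemma. The
  coordinate \<open>y\<close> starts at 0, since columns move as a whole.\<close>
lemma dense_orbit:
  obtains x z where "x \<in> open_unit" "z \<in> open_unit"
    "\<And>V. open V \<Longrightarrow> V \<inter> box 0 1 \<noteq> {} \<Longrightarrow> \<exists>n. (F_3D ^^ n) (vector [x, 0, z]) \<in> V"
proof -
  define square where "square = {0..1::real} \<times> {0..1::real}"
  define visits where "visits V = \<Union>{X \<times> Z | X Z. open X \<and> open Z \<and> X \<subseteq> open_unit \<and> Z \<subseteq> open_unit \<and>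
      (\<exists>n. \<forall>x\<in>X. \<forall>z\<in>Z. (F_3D ^^ n) (vector [x, 0, z]) \<in> V)}" for V
  have visits_sub: "visits V \<subseteq> open_unit \<times> open_unit" for V
    unfolding visits_def by blast
  have "open_unit \<times> open_unit \<subseteq> square"
    by (auto simp: square_def)
  have "open (visits V)" for V
    unfolding visits_def by (intro open_Union) (auto intro: open_Times)
  then have ope: "openin (top_of_set square) (visits V)" for V
    using visits_sub \<open>open_unit \<times> open_unit \<subseteq> square\<close> by (meson open_subset order_trans)
  have dense: "square \<subseteq> closure (visits V)" if V: "open V" "V \<inter> box 0 1 \<noteq> {}" for V
  proof -
    have "p \<in> closure (visits V)" if p: "p \<in> open_unit \<times> open_unit" for p
      unfolding closure_iff_nhds_not_empty
    proof (intro allI impI)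
      fix A T assume "T \<subseteq> A" "open T" "p \<in> T"
      then obtain X Z where XZ: "open X" "open Z" "p \<in> X \<times> Z" "X \<times> Z \<subseteq> T"
        by (metis open_prod_elim)
      have "open (X \<inter> open_unit)" "X \<inter> open_unit \<noteq> {}" "open (Z \<inter> open_unit)" "Z \<inter> open_unit \<noteq> {}"
        using XZ p by auto
      then obtain X' Z' n where hit: "open X'" "X' \<noteq> {}" "X' \<subseteq> X \<inter> open_unit" "open Z'" "Z' \<noteq> {}"
        "Z' \<subseteq> Z \<inter> open_unit"
        "\<And>x y z. x \<in> X' \<Longrightarrow> y \<in> {0..1} \<Longrightarrow> z \<in> Z' \<Longrightarrow> (F_3D ^^ n) (vector [x, y, z]) \<in> V"
        using columns_reach[OF V, of "X \<inter> open_unit" "Z \<inter> open_unit"] by (metis inf_le2)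
      have "\<forall>x\<in>X'. \<forall>z\<in>Z'. (F_3D ^^ n) (vector [x, 0, z]) \<in> V"
        by (intro ballI hit(7)) auto
      moreover have "X' \<subseteq> open_unit" "Z' \<subseteq> open_unit"
        using hit(3,6) by blast+
      ultimately have "X' \<times> Z' \<subseteq> visits V"
        unfolding visits_def using hit(1,4)
        by (intro Union_upper CollectI exI[of _ X'] exI[of _ Z'] conjI refl exI[of _ n])
      moreover have "X' \<times> Z' \<subseteq> A" "X' \<times> Z' \<noteq> {}"
        using hit(2,3,5,6) XZ(4) \<open>T \<subseteq> A\<close> by blast+
      ultimately show "visits V \<inter> A \<noteq> {}"
        by blast
    qed
    then have "closure (open_unit \<times> open_unit) \<subseteq> closure (visits V)"
      by (intro closure_minimal) auto
    then show ?thesis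
      by (simp add: closure_Times square_def)
  qed
  obtain B :: "(real ^ 3) set set" where B: "countable B" "topological_basis B"
    using ex_countable_basis by blast
  define \<G> where "\<G> = visits ` insert UNIV {V \<in> B. V \<inter> box 0 1 \<noteq> {}}"
  have "square \<subseteq> closure (\<Inter>\<G>)"
  proof (rule Baire)
    show "closed square"
      by (simp add: square_def closed_Times)
    show "countable \<G>"
      unfolding \<G>_def using B(1) by (intro countable_image countable_insert) simp
    show "openin (top_of_set square) T \<and> square \<subseteq> closure T" if "T \<in> \<G>" for T
    proof -
      have "UNIV \<inter> box (0 :: real ^ 3) 1 \<noteq> {}"
        by (simp add: interval_ne_empty_cart)
      then show ?thesis
        using that ope dense topological_basis_open[OF B(2)] unfolding \<G>_def by blast
    qed
  qed
  moreover have "square \<noteq> {}"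
    by (auto simp: square_def)
  ultimately have "\<Inter>\<G> \<noteq> {}"
    by auto
  then obtain x z where xz: "(x, z) \<in> \<Inter>\<G>"
    by auto
  show ?thesis
  proof
    show "x \<in> open_unit" "z \<in> open_unit"
      using xz visits_sub[of UNIV] unfolding \<G>_def by blast+
    fix V :: "(real ^ 3) set" assume V: "open V" "V \<inter> box 0 1 \<noteq> {}"
    then obtain p where "p \<in> V" "p \<in> box 0 1" by blast
    then obtain b where b: "b \<in> B" "p \<in> b" "b \<subseteq> V"
      using topological_basisE[OF B(2) V(1)] by metis
    then have "(x, z) \<in> visits b"
      using xz \<open>p \<in> box 0 1\<close> unfolding \<G>_def by blast
    then show "\<exists>n. (F_3D ^^ n) (vector [x, 0, z]) \<in> V"
      unfolding visits_def using b(3) by blast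
  qed
qed

lemma dense_trajectory_3D: "\<exists>v\<in>unit_cube. dense_in (range (\<lambda>n. (F_3D ^^ n) v)) unit_cube"
  and dense_trajectory_2D: "\<exists>v\<in>unit_cube. dense_in (range (\<lambda>n. (F_2D ^^ n) v)) unit_cube"
proof -
  obtain x z where xz: "x \<in> open_unit" "z \<in> open_unit"
    and visit: "\<And>V. open V \<Longrightarrow> V \<inter> box 0 1 \<noteq> {} \<Longrightarrow> \<exists>n. (F_3D ^^ n) (vector [x, 0, z]) \<in> V"
    using dense_orbit by blast
  define v :: "real ^ 3" where "v = vector [x, 0, z]"
  have v: "v \<in> unit_cube"
    using xz by (simp add: v_def unit_cube_def forall_3)
  have "dense_in (range (\<lambda>n. (F_3D ^^ n) v)) unit_cube"
    using visit F_3D_funpow_unit_cube[OF v] unfolding v_def[symmetric]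
    by (intro dense_in_unit_cubeI) blast
  then show "\<exists>v\<in>unit_cube. dense_in (range (\<lambda>n. (F_3D ^^ n) v)) unit_cube"
    using v by blast
  have "dense_in (range (\<lambda>n. (F_2D ^^ n) (proj_xz v))) unit_cube"
  proof (rule dense_in_unit_cubeI)
    fix U :: "(real ^ 2) set" assume U: "open U" "U \<inter> box 0 1 \<noteq> {}"
    obtain n where "(F_3D ^^ n) v \<in> proj_xz -` U"
      using visit[OF open_proj_xz_vimage[OF U]] v_def by blast
    then have "(F_2D ^^ n) (proj_xz v) \<in> U \<inter> unit_cube"
      using F_2D_funpow_proj_xz[OF v] proj_xz_unit_cube F_3D_funpow_unit_cube[OF v] by simp
    then show "U \<inter> (range (\<lambda>n. (F_2D ^^ n) (proj_xz v)) \<inter> unit_cube) \<noteq> {}"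
      by blast
  qed
  then show "\<exists>v\<in>unit_cube. dense_in (range (\<lambda>n. (F_2D ^^ n) v)) unit_cube"
    using proj_xz_unit_cube[OF v] by blast
qed

section \<open>Images of the cube and the square, and hetero-chaos\<close>

lemma hetero_chaos_clauses_unit_cubeI:
  fixes G :: "real ^ 'n::finite \<Rightarrow> real ^ 'n"
  assumes "\<And>m. m \<in> {1, 2} \<Longrightarrow> dense_in (unstable_hyperbolic_points unit_cube G m) unit_cube"
    and "\<exists>v\<in>unit_cube. dense_in (range (\<lambda>n. (G ^^ n) v)) unit_cube"
  shows "hetero_chaos_clauses unit_cube G unit_cube"
proof -
  have "uncountable (cbox (0 :: real ^ 'n) 1)"
  proof (rule uncountable_convex)
    show "(0 :: real ^ 'n) \<in> cbox 0 1" "(1 :: real ^ 'n) \<in> cbox 0 1"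
      by (simp_all add: mem_box_cart)
  qed simp_all
  then show ?thesis
    using assms(1)[of 1] assms(1)[of 2] assms(2)
    unfolding hetero_chaos_clauses_def
    by (intro conjI exI[of _ "1::nat"] exI[of _ "2::nat"]) (simp_all add: unit_cube_eq_cbox)
qed

text \<open>The height \<open>y\<close> tells whether \<open>B\<close> or \<open>C\<close> was used last, and \<open>z\<close> separates \<open>A\<close> from \<open>D\<close>.\<close>
lemma interior_subset_F_3D_image: "interior unit_cube \<subseteq> F_3D ` unit_cube"
proof
  fix v :: "real ^ 3" assume "v \<in> interior unit_cube"
  then have unit: "v $ i \<in> open_unit" for i
    by (simp add: unit_cube_eq_cbox mem_box_cart)
  define x y z where xyz: "x = v $ 1" "y = v $ 2" "z = v $ 3"
  have v: "v = vector [x, y, z]"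
    by (simp add: xyz vec_eq_iff forall_3)
  have bounds: "0 < x" "x < 1" "0 < y" "y < 1" "0 < z" "z < 1"
    using unit by (simp_all add: xyz)
  note t = tau_inverse_branches[of x]
  consider "y < 2/3" "z \<le> 1/2" | "y < 2/3" "z > 1/2" | "2/3 \<le> y" "y < 5/6" | "5/6 \<le> y"
    by linarith
  then have "\<exists>v'\<in>unit_cube. F_3D v' = v"
  proof cases
    case 1
    then show ?thesis
      using bounds t by (intro bexI[of _ "vector [x / 3, 3/2 * y, 2 * z]"])
        (simp_all add: v unit_cube_def forall_3 F_3D_def A_reg_def)
  next
    case 2
    then show ?thesis
      using bounds t by (intro bexI[of _ "vector [(x + 1) / 3, 3/2 * y, 2 * z - 1]"])
        (simp_all add: v unit_cube_def forall_3 F_3D_def A_reg_def B_reg_def C_reg_def D_reg_def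
          field_simps)
  next
    case 3
    then show ?thesis
      using bounds t by (intro bexI[of _ "vector [(x + 2) / 3, 6 * y - 4, z / 2]"])
        (simp_all add: v unit_cube_def forall_3 F_3D_def A_reg_def B_reg_def field_simps)
  next
    case 4
    then show ?thesis
      using bounds t by (intro bexI[of _ "vector [(x + 2) / 3, 6 * y - 5, (z + 1) / 2]"])
        (simp_all add: v unit_cube_def forall_3 F_3D_def A_reg_def B_reg_def C_reg_def field_simps)
  qed
  then show "v \<in> F_3D ` unit_cube"
    by blast
qed

text \<open>The projection of the piece \<open>C\<close> alone, which is closed, is already mapped onto the square.\<close>
lemma F_2D_image_unit_cube: "F_2D ` unit_cube = unit_cube"
proof
  show "F_2D ` unit_cube \<subseteq> unit_cube"
  proof
    fix w assume "w \<in> F_2D ` unit_cube"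
    then obtain v :: "real ^ 2" where v: "v \<in> unit_cube" "w = proj_xz (F_3D (vector [v $ 1, 0, v $ 2]))"
      by (auto simp: F_2D_def)
    then have "(vector [v $ 1, 0, v $ 2] :: real ^ 3) \<in> unit_cube"
      by (simp add: unit_cube_def forall_3)
    then show "w \<in> unit_cube"
      using v(2) proj_xz_unit_cube F_3D_image_unit_cube by blast
  qed
  show "unit_cube \<subseteq> F_2D ` unit_cube"
  proof
    fix v :: "real ^ 2" assume "v \<in> unit_cube"
    then have bounds: "0 \<le> v $ 1" "v $ 1 \<le> 1" "0 \<le> v $ 2" "v $ 2 \<le> 1"
      by (auto simp: unit_cube_def)
    have "tau ((v $ 1 + 2) / 3) = v $ 1"
    proof (cases "v $ 1 = 1")
      case False
      then have "frac (v $ 1 + 2) = v $ 1" "(v $ 1 + 2) / 3 \<noteq> 1"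
        using bounds by (simp_all add: frac_unique_iff)
      moreover have "3 * ((v $ 1 + 2) / 3) = v $ 1 + 2"
        by simp
      ultimately show ?thesis
        by (simp only: tau_def if_False)
    qed (simp add: tau_def)
    then have "F_2D (vector [(v $ 1 + 2) / 3, (v $ 2 + 1) / 2]) = vector [v $ 1, v $ 2]"
      using bounds
      by (simp add: F_2D_def proj_xz_def F_3D_def A_reg_def B_reg_def C_reg_def field_simps)
    also have "\<dots> = v"
      by (simp add: vec_eq_iff forall_2)
    finally have "F_2D (vector [(v $ 1 + 2) / 3, (v $ 2 + 1) / 2]) = v" .
    moreover have "(vector [(v $ 1 + 2) / 3, (v $ 2 + 1) / 2] :: real ^ 2) \<in> unit_cube"
      using bounds by (simp add: unit_cube_def forall_2)
    ultimately show "v \<in> F_2D ` unit_cube"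
      by (metis imageI)
  qed
qed

theorem theorem1p1:
  shows "hetero_chaotic (unit_cube :: (real ^ 2) set) F_2D \<and>
         hetero_chaotic_up_to_boundary (unit_cube :: (real ^ 3) set) F_3D"
proof
  show "hetero_chaotic (unit_cube :: (real ^ 2) set) F_2D"
    using F_2D_image_unit_cube
      hetero_chaos_clauses_unit_cubeI[OF unstable_points_dense_2D dense_trajectory_2D]
    by (simp add: hetero_chaotic_def hetero_chaotic_on_def invariant_set_def)
  show "hetero_chaotic_up_to_boundary (unit_cube :: (real ^ 3) set) F_3D"
    using F_3D_image_unit_cube interior_subset_F_3D_image
      hetero_chaos_clauses_unit_cubeI[OF unstable_points_dense_3D dense_trajectory_3D]
    by (auto simp: hetero_chaotic_up_to_boundary_def)
qed

end
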